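(* Let $F=f+\psi:\mathbb{R}^n\to\mathbb{R}\cup\{+\infty\}$, the sampling $\hat S$ and the vector $v$ be as in the context, with $(f,\hat S)\sim\mathrm{ESO}(v)$. Assume that $\mathcal{X}^*=\{x^*\}$ and that for some $\mu>0$, $F(x)\ge F^*+\frac{\mu}{2}\|x-x^*\|_v^2$ for all $x$ with $F(x)<+\infty$. Let $\theta_0=\tau/n$ and $$\Delta(x)=\frac{1-\theta_0}{\theta_0^2}(F(x)-F^* )+\frac{1}{2\theta_0^2}\operatorname{dist}_v(x,\mathcal{X}^* )^2 .$$ Let $K$ be an integer with $K\ge n/\tau$ and run APPROX with restart from $x_0\in\operatorname{dom}\psi$ with all restart periods equal, $K_r=K$ for every $r\ge0$. Then for all $r\ge0$, $$\mathbf{E}[\Delta(\bar x_r)]\le\left(\frac{1+(1-\theta_0)\mu}{1+\frac{\theta_0^2}{2\theta_{K-1}^2}\mu}\right)^{r}\Delta(x_0).$$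
   Context: Problem. $F(x)=f(x)+\psi(x)$ on $\mathbb{R}^n$, where $f:\mathbb{R}^n\to\mathbb{R}$ is convex and differentiable and $\psi(x)=\sum_{i=1}^n\psi^i(x^i)$ with each $\psi^i:\mathbb{R}\to\mathbb{R}\cup\{+\infty\}$ closed, proper and convex. $F^*$ is the minimum value of $F$ and $\mathcal{X}^*$ the set of minimizers, assumed nonempty. For a vector $v\in\mathbb{R}^n$ with positive entries, $\|x\|_v^2=\sum_i v_i(x^i)^2$ and $\operatorname{dist}_v(x,\mathcal{X}^* )$ is the distance to $\mathcal{X}^*$ in the norm $\|\cdot\|_v$. Sampling and ESO. $\hat S$ is a random subset of $\{1,\dots,n\}$ with $\mathbf{P}(i\in\hat S)=\mathbf{P}(j\in\hat S)$ for all $i,j$, and $\tau=\mathbf{E}[|\hat S|]>0$. For $h\in\mathbb{R}^n$, $h_{[S]}=\sum_{i\in S}h^ie_i$. $(f,\hat S)\sim\mathrm{ESO}(v)$ means: for all $x,h\in\mathbb{R}^n$, $\mathbf{E}[f(x+h_{[\hat S]})]\le f(x)+\frac{\tau}{n}\big(\langle\nabla f(x),h\rangle+\frac12\|h\|_v^2\big)$. APPROX$(f,\psi,x_0,K)$: set $\theta_0=\tau/n$, $z_0=x_0$. For $k=0,\dots,K-1$: $y_k=(1-\theta_k)x_k+\theta_kz_k$; draw $S_k$ distributed as $\hat S$, independently of the past; for $i\in S_k$ set $z_{k+1}^i=\arg\min_{z\in\mathbb{R}}\{\nabla_if(y_k)(z-y_k^i)+\frac{\theta_knv_i}{2\tau}|z-z_k^i|^2+\psi^i(z)\}$,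 and $z_{k+1}^i=z_k^i$ for $i\notin S_k$; $x_{k+1}=y_k+\frac n\tau\theta_k(z_{k+1}-z_k)$; $\theta_{k+1}=\frac{\sqrt{\theta_k^4+4\theta_k^2}-\theta_k^2}{2}$. Return $x_K$. APPROX with restart: set $\bar x_0=x_0$. For $r\ge0$: $\bar x_{r+1}=$ APPROX$(f,\psi,\bar x_r,K_r)$, run with fresh independent randomness. *)

theory Defs
  imports "HOL-Probability.Probability"
begin

definition ereal_epigraph :: "(real \<Rightarrow> ereal) \<Rightarrow> (real \<times> real) set" where
  "ereal_epigraph g = {(x, t). g x \<le> ereal t}"

definition closed_proper_convex :: "(real \<Rightarrow> ereal) \<Rightarrow> bool" where
  "closed_proper_convex g \<longleftrightarrow>
     closed (ereal_epigraph g) \<and> convex (ereal_epigraph g) \<and>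
     (\<forall>x. g x \<noteq> -\<infinity>) \<and> (\<exists>x. g x \<noteq> \<infinity>)"

definition separable :: "('n::finite \<Rightarrow> real \<Rightarrow> ereal) \<Rightarrow> real^'n \<Rightarrow> ereal" where
  "separable \<psi> x = (\<Sum>i\<in>UNIV. \<psi> i (x $ i))"

definition objective ::
    "(real^'n::finite \<Rightarrow> real) \<Rightarrow> ('n \<Rightarrow> real \<Rightarrow> ereal) \<Rightarrow> real^'n \<Rightarrow> ereal" where
  "objective f \<psi> x = ereal (f x) + separable \<psi> x"

definition minimum_value :: "('a \<Rightarrow> ereal) \<Rightarrow> ereal" where
  "minimum_value F = (INF x. F x)"

definition minimizers :: "('a \<Rightarrow> ereal) \<Rightarrow> 'a set" where
  "minimizers F = {x. \<forall>y. F x \<le> F y}"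

definition norm_wt :: "real^'n::finite \<Rightarrow> real^'n \<Rightarrow> real" where
  "norm_wt v x = sqrt (\<Sum>i\<in>UNIV. v $ i * (x $ i)\<^sup>2)"

definition dist_wt :: "real^'n::finite \<Rightarrow> real^'n \<Rightarrow> (real^'n) set \<Rightarrow> real" where
  "dist_wt v x X = (INF y\<in>X. norm_wt v (x - y))"

text \<open>A random subset of the coordinates is represented by its law, a pmf on the finite type of
  subsets.\<close>

definition uniform_sampling :: "'n::finite set pmf \<Rightarrow> bool" where
  "uniform_sampling D \<longleftrightarrow>
     (\<forall>i j. measure_pmf.prob D {S. i \<in> S} = measure_pmf.prob D {S. j \<in> S})"

definition tau :: "'n::finite set pmf \<Rightarrow> real" where
  "tau D = measure_pmf.expectation D (\<lambda>S. real (card S))"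

definition restrict_coords :: "'n::finite set \<Rightarrow> real^'n \<Rightarrow> real^'n" where
  "restrict_coords S h = (\<chi> i. if i \<in> S then h $ i else 0)"

text \<open>In what follows \<open>gf\<close> stands for the gradient of \<open>f\<close>.\<close>

definition ESO ::
    "(real^'n::finite \<Rightarrow> real) \<Rightarrow> (real^'n \<Rightarrow> real^'n) \<Rightarrow> 'n set pmf \<Rightarrow> real^'n \<Rightarrow> bool" where
  "ESO f gf D v \<longleftrightarrow>
     (\<forall>x h. measure_pmf.expectation D (\<lambda>S. f (x + restrict_coords S h))
        \<le> f x + tau D / real CARD('n) * (inner (gf x) h + 1 / 2 * (norm_wt v h)\<^sup>2))"

primrec theta :: "real \<Rightarrow> nat \<Rightarrow> real" where
  "theta t0 0 = t0"
| "theta t0 (Suc k) = (sqrt ((theta t0 k) ^ 4 + 4 * (theta t0 k)\<^sup>2) - (theta t0 k)\<^sup>2) / 2"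

definition theta_seq :: "'n::finite set pmf \<Rightarrow> nat \<Rightarrow> real" where
  "theta_seq D = theta (tau D / real CARD('n))"

text \<open>One iteration, as a function of the pair \<open>(x\<^sub>k, z\<^sub>k)\<close> and of the sampled set \<open>S\<^sub>k\<close>. The
  one-dimensional problems have a unique minimizer when each \<open>\<psi> i\<close> is closed, proper and convex,
  so the choice made by \<open>arg_min\<close> is immaterial.\<close>

definition approx_update ::
    "(real^'n::finite \<Rightarrow> real^'n) \<Rightarrow> ('n \<Rightarrow> real \<Rightarrow> ereal) \<Rightarrow> real^'n \<Rightarrow> 'n set pmf \<Rightarrow> nat
      \<Rightarrow> (real^'n) \<times> (real^'n) \<Rightarrow> 'n set \<Rightarrow> (real^'n) \<times> (real^'n)" where
  "approx_update gf \<psi> v D k = (\<lambda>(x, z) S.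
     let n = real CARD('n);
         \<theta> = theta_seq D k;
         y = (1 - \<theta>) *\<^sub>R x + \<theta> *\<^sub>R z;
         z' = (\<chi> i. if i \<in> S
                 then arg_min (\<lambda>u. ereal (gf y $ i * (u - y $ i)
                          + \<theta> * n * v $ i / (2 * tau D) * \<bar>u - z $ i\<bar>\<^sup>2) + \<psi> i u) (\<lambda>_. True)
                 else z $ i)
     in (y + (n / tau D * \<theta>) *\<^sub>R (z' - z), z'))"

text \<open>Binding to \<open>D\<close> at each step draws \<open>S\<^sub>k\<close> independently of everything drawn before.\<close>

primrec approx_state ::
    "(real^'n::finite \<Rightarrow> real^'n) \<Rightarrow> ('n \<Rightarrow> real \<Rightarrow> ereal) \<Rightarrow> real^'n \<Rightarrow> 'n set pmf \<Rightarrow> real^'n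
      \<Rightarrow> nat \<Rightarrow> ((real^'n) \<times> (real^'n)) pmf" where
  "approx_state gf \<psi> v D x0 0 = return_pmf (x0, x0)"
| "approx_state gf \<psi> v D x0 (Suc k) =
     bind_pmf (approx_state gf \<psi> v D x0 k) (\<lambda>s. map_pmf (approx_update gf \<psi> v D k s) D)"

definition approx ::
    "(real^'n::finite \<Rightarrow> real^'n) \<Rightarrow> ('n \<Rightarrow> real \<Rightarrow> ereal) \<Rightarrow> real^'n \<Rightarrow> 'n set pmf \<Rightarrow> real^'n
      \<Rightarrow> nat \<Rightarrow> (real^'n) pmf" where
  "approx gf \<psi> v D x0 K = map_pmf fst (approx_state gf \<psi> v D x0 K)"

primrec approx_restart ::
    "(real^'n::finite \<Rightarrow> real^'n) \<Rightarrow> ('n \<Rightarrow> real \<Rightarrow> ereal) \<Rightarrow> real^'n \<Rightarrow> 'n set pmf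
      \<Rightarrow> (nat \<Rightarrow> nat) \<Rightarrow> real^'n \<Rightarrow> nat \<Rightarrow> (real^'n) pmf" where
  "approx_restart gf \<psi> v D Ks x0 0 = return_pmf x0"
| "approx_restart gf \<psi> v D Ks x0 (Suc r) =
     bind_pmf (approx_restart gf \<psi> v D Ks x0 r) (\<lambda>x. approx gf \<psi> v D x (Ks r))"

definition Delta ::
    "(real^'n::finite \<Rightarrow> ereal) \<Rightarrow> real^'n \<Rightarrow> real \<Rightarrow> real^'n \<Rightarrow> ereal" where
  "Delta F v \<theta>\<^sub>0 x =
     ereal ((1 - \<theta>\<^sub>0) / \<theta>\<^sub>0\<^sup>2) * (F x - minimum_value F)
       + ereal (1 / (2 * \<theta>\<^sub>0\<^sup>2) * (dist_wt v x (minimizers F))\<^sup>2)"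

text \<open>Expectation of a nonnegative extended real valued function; \<open>e2ennreal\<close> would truncate
  negative values, but \<open>Delta\<close> is nonnegative when \<open>0 < \<theta>\<^sub>0 \<le> 1\<close>.\<close>

definition expectation_ext :: "'a pmf \<Rightarrow> ('a \<Rightarrow> ereal) \<Rightarrow> ereal" where
  "expectation_ext p X = enn2ereal (\<integral>\<^sup>+ x. e2ennreal (X x) \<partial>measure_pmf p)"

end

theory Submission
  imports Defs
begin

text \<open>
  Write $t = \theta_0 = \tau/n$ and let $x_k, z_k$ be the iterates of one run of APPROX from $x_0$. The
  classical estimate
  $$\mathbf{E}\Big[\frac{F(x_K) - F^*}{\theta_{K-1}^2} + \frac{\|z_K - x^*\|_v^2}{2t^2}\Big]
    \le \Delta(x_0)$$
  controls the distance of $z_K$ from the minimizer, whereas the next restart begins at $x_K$. The key to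
  the theorem is the companion estimate for $x_K$,
  $$\mathbf{E}\Big[\frac{F(x_K) - F^*}{2\theta_{K-1}^2} + \frac{\|x_K - x^*\|_v^2}{2t^2}\Big]
    \le \Delta(x_0),$$
  proved in \<open>approx_distance_gap_bound\<close>. Given quadratic growth, the expected
  $\Delta(x_K)$ is a nonnegative combination of this estimate and of the growth inequality
  (\<open>approx_contraction\<close>). The condition $K \ge n/\tau$ makes the second multiplier nonnegative. Since
  the restarts use fresh randomness, the contraction factors multiply (\<open>approx_restart_contraction\<close>).

  The companion estimate is easiest to see in the continuous-time model $x'' + \frac3s x' + \nabla f(x) = 0$
  with $x^* = 0$, $f^* = 0$ and $R = \|x(0)\|$. With $z = x + \frac s2 x'$ the classical estimate is
  $\|z\|^2 + \frac{s^2}2 f(x) \le R^2$, and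
  $$\frac{d}{ds}\big(s^2\|x\|^2\big) = 2s\big(\|z\|^2 - \|z - x\|^2\big)
    \le 2sR^2 - s^3\big(f(x) + \tfrac12\|x'\|^2\big).$$
  The mechanical energy $f(x) + \frac12\|x'\|^2$ decreases with time, so integration yields
  $s^2 R^2 - s^2\|x\|^2 \ge \frac{s^4}4 f(x)$, which is the claim.

  In discrete time both facts about the dynamics come from the same one-step inequality
  (\<open>expected_cost_step\<close>): comparing with $x^*$ gives the classical estimate, and comparing with the
  current point $x_k$ gives the decay of the energy. The integration becomes a Lyapunov argument on the
  real sequences of expectations (\<open>accelerated_sequence_bound\<close>), in which the kinetic energy is
  represented by $\|x_k - z_k\|_v^2$.

  Only finitely many outcomes are possible at every step, so all expectations are finite sums and no
  integrability questions arise.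
\<close>

section \<open>The step-size sequence\<close>

lemma theta_recurrence:
  assumes "t > 0"
  shows "theta t (Suc k) > 0" and "(theta t (Suc k))\<^sup>2 = (1 - theta t (Suc k)) * (theta t k)\<^sup>2"
proof -
  have step: "s > 0 \<and> s\<^sup>2 = (1 - s) * b\<^sup>2"
    if "b > 0" and s: "s = (sqrt (b ^ 4 + 4 * b\<^sup>2) - b\<^sup>2) / 2" for b s :: real
  proof -
    have root: "2 * s + b\<^sup>2 = sqrt (b ^ 4 + 4 * b\<^sup>2)" using s by simp
    have pos: "b ^ 4 + 4 * b\<^sup>2 > (b\<^sup>2)\<^sup>2" using \<open>b > 0\<close> by (simp flip: power_mult)
    then have "sqrt (b ^ 4 + 4 * b\<^sup>2) > b\<^sup>2"
      using real_less_rsqrt by blast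
    moreover have "(2 * s + b\<^sup>2)\<^sup>2 = b ^ 4 + 4 * b\<^sup>2"
      unfolding root by simp
    then have "s\<^sup>2 = (1 - s) * b\<^sup>2"
      by (simp add: power2_eq_square power4_eq_xxxx algebra_simps)
    ultimately show ?thesis using root by linarith
  qed
  have pos: "theta t j > 0" for j
  proof (induction j)
    case (Suc j)
    then show ?case using step[OF Suc, of "theta t (Suc j)"] by simp
  qed (use assms in simp)
  show "theta t (Suc k) > 0" "(theta t (Suc k))\<^sup>2 = (1 - theta t (Suc k)) * (theta t k)\<^sup>2"
    using step[OF pos, of "theta t (Suc k)" k] by simp_all
qed

text \<open>All further facts about the sequence follow from the quadratic recurrence; the explicit square
  root would only obstruct simplification.\<close>

declare theta.simps(2) [simp del]

lemma theta_pos: "t > 0 \<Longrightarrow> theta t k > 0"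
  by (cases k) (simp, metis theta_recurrence(1))

lemma theta_Suc_less_one:
  assumes "t > 0"
  shows "theta t (Suc k) < 1"
proof (rule ccontr)
  assume "\<not> theta t (Suc k) < 1"
  then have "(1 - theta t (Suc k)) * (theta t k)\<^sup>2 \<le> 0"
    by (intro mult_nonpos_nonneg) auto
  moreover have "(theta t (Suc k))\<^sup>2 > 0"
    using theta_recurrence(1)[OF assms, of k] by simp
  ultimately show False
    using theta_recurrence(2)[OF assms, of k] by linarith
qed

lemma theta_Suc_less:
  assumes "t > 0"
  shows "theta t (Suc k) < theta t k"
proof -
  have "(theta t (Suc k))\<^sup>2 < 1 * (theta t k)\<^sup>2"
    unfolding theta_recurrence(2)[OF assms]
    by (rule mult_strict_right_mono)
      (use theta_recurrence(1)[OF assms, of k] theta_pos[OF assms, of k] in auto)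
  then show ?thesis
    using theta_pos[OF assms, of k] power2_less_imp_less[of "theta t (Suc k)" "theta t k"] by simp
qed

lemma theta_le_start: "t > 0 \<Longrightarrow> theta t k \<le> t"
proof (induction k)
  case (Suc k)
  then show ?case using theta_Suc_less[of t k] by simp
qed simp

lemma theta_Suc_less_start: "t > 0 \<Longrightarrow> theta t (Suc k) < t"
  using theta_Suc_less[of t k] theta_le_start[of t k] by simp

text \<open>The recurrence reads $(1/\theta_{k+1} - 1/2)^2 - 1/4 = 1/\theta_k^2$, so each step increases
  $1/\theta_k$ by at least one half.\<close>

lemma inverse_theta_growth:
  assumes "t > 0"
  shows "1 / theta t k \<ge> 1 / t + real k / 2"
proof (induction k)
  case (Suc k)
  let ?s = "theta t (Suc k)" and ?b = "theta t k"
  have s: "?s > 0" and b: "?b > 0" using theta_pos[OF assms] by blast+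
  have "1 / ?b\<^sup>2 = (1 - ?s) / ?s\<^sup>2"
    using theta_recurrence(2)[OF assms, of k] s b by (simp add: field_simps)
  also have "\<dots> = (1 / ?s)\<^sup>2 - 1 / ?s"
    using s by (simp add: field_simps power2_eq_square)
  also have "\<dots> \<le> (1 / ?s - 1 / 2)\<^sup>2"
    by (simp add: power2_eq_square algebra_simps)
  finally have "(1 / ?b)\<^sup>2 \<le> (1 / ?s - 1 / 2)\<^sup>2"
    by (simp add: power_divide)
  moreover have "1 / ?s - 1 / 2 \<ge> 0"
    using theta_Suc_less_one[OF assms, of k] s by (simp add: field_simps)
  ultimately have "1 / ?b \<le> 1 / ?s - 1 / 2"
    by (rule power2_le_imp_le)
  with Suc show ?case by (simp add: field_simps)
qed simp

text \<open>In APPROX, $x_{k+1} = (1-\theta_k) x_k - (\theta_k/t - \theta_k) z_k + (\theta_k/t) z_{k+1}$,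
  where the weight of \<open>z\<^sub>k\<close> is nonpositive. But \<open>x\<^sub>k\<close> itself contains \<open>z\<^sub>k\<close> with weight
  $\theta_{k-1}/t$, and the total is nonnegative by this inequality, which amounts to
  $1 - t \le \theta_{k+1}/\theta_k = \sqrt{1-\theta_{k+1}}$.\<close>

lemma theta_weight_nonneg:
  assumes "0 < t" "t \<le> 1"
  shows "(1 - theta t (Suc k)) * (theta t k / t) \<ge> theta t (Suc k) / t - theta t (Suc k)"
proof -
  let ?s = "theta t (Suc k)" and ?b = "theta t k"
  have s: "?s > 0" and b: "?b > 0" using theta_pos[OF assms(1)] by blast+
  have st: "?s \<le> t" using theta_le_start[OF assms(1)] .
  have "((1 - t) * ?b)\<^sup>2 = (1 - t) * ((1 - t) * ?b\<^sup>2)" by (simp add: power2_eq_square)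
  also have "\<dots> \<le> 1 * ((1 - ?s) * ?b\<^sup>2)"
    by (intro mult_mono) (use assms st s in auto)
  also have "\<dots> = ?s\<^sup>2" using theta_recurrence(2)[OF assms(1), of k] by simp
  finally have "(1 - t) * ?b \<le> ?s"
    using s power2_le_imp_le[of "(1 - t) * ?b" ?s] by simp
  then have "(1 - t) * ?b * ?s \<le> ?s * ?s"
    using s by (simp add: mult_right_mono)
  then have "(1 - t) * ?s \<le> ?s\<^sup>2 / ?b"
    using b by (simp add: field_simps power2_eq_square)
  also have "\<dots> = (1 - ?s) * ?b"
    using theta_recurrence(2)[OF assms(1), of k] b by (simp add: field_simps power2_eq_square)
  finally have "(1 - t) * ?s / t \<le> (1 - ?s) * ?b / t"
    using assms by (simp add: divide_right_mono)
  moreover have "(1 - t) * ?s / t = ?s / t - ?s" using assms by (simp add: field_simps)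
  ultimately show ?thesis by simp
qed

section \<open>A Lyapunov argument for accelerated sequences\<close>

text \<open>Coefficients of the Lyapunov inequality in \<open>accelerated_sequence_bound\<close>. Writing
  $q_k = \theta_k/t$, the gap is weighted by $\max(1, 2q_k)$: the term $2q_k$ is what the weight of the
  newest point \<open>z\<^sub>k\<^sub>+\<^sub>1\<close> in \<open>x\<^sub>k\<^sub>+\<^sub>1\<close> provides at once, while the energy decay keeps the weight at
  least $1$ when $q_k$ has become small.\<close>

definition gap_weight :: "real \<Rightarrow> nat \<Rightarrow> real" where
  "gap_weight t k = max 1 (2 * (theta t k / t))"

text \<open>The weight of the squared distance between the two iterates. Its value is forced: it is the one
  for which the cross terms, whose sign is unknown, cancel in the Lyapunov step. At the first step
  $\theta_k = t$ the denominator is zero, which is harmless because the two iterates then coincide.\<close>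

definition spread_weight :: "real \<Rightarrow> nat \<Rightarrow> real" where
  "spread_weight t k =
     (gap_weight t k - 2 * (theta t k / t) * theta t k) / ((1 - theta t k) * (1 - theta t k / t))"

lemma spread_weight_decreasing:
  assumes "0 < t" "t \<le> 1"
  shows "spread_weight t (Suc (Suc k)) * (1 - theta t (Suc (Suc k))) \<le> spread_weight t (Suc k)"
proof -
  let ?s = "theta t (Suc (Suc k))" and ?b = "theta t (Suc k)"
  let ?q = "?s / t" and ?p = "?b / t"
  have s: "0 < ?s" "?s < 1" "?s < ?b" and b: "0 < ?b" "?b < 1"
    using theta_pos[OF assms(1)] theta_Suc_less_one[OF assms(1)] theta_Suc_less[OF assms(1)]
    by blast+
  have "?b < t" using theta_Suc_less_start[OF assms(1)] .
  then have p: "?p < 1" and qp: "?q \<le> ?p" and q: "0 < ?q"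
    using assms s by (auto simp: field_simps)
  have "spread_weight t (Suc (Suc k)) * (1 - ?s) = (gap_weight t (Suc (Suc k)) - 2 * ?q * ?s) / (1 - ?q)"
    using s by (simp add: spread_weight_def)
  also have "\<dots> \<le> gap_weight t (Suc k) / (1 - ?p)"
  proof (rule frac_le)
    have "0 \<le> 2 * ?q * ?s" using s q by (intro mult_nonneg_nonneg) auto
    then show "gap_weight t (Suc (Suc k)) - 2 * ?q * ?s \<le> gap_weight t (Suc k)"
      using qp by (simp add: gap_weight_def max_def)
  qed (use qp p in \<open>auto simp: gap_weight_def\<close>)
  also have "\<dots> = gap_weight t (Suc k) * (1 - ?b) / ((1 - ?b) * (1 - ?p))"
    using b by simp
  also have "\<dots> \<le> spread_weight t (Suc k)"
    unfolding spread_weight_def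
  proof (rule divide_right_mono)
    have "2 * ?p * ?b \<le> gap_weight t (Suc k) * ?b"
      using b by (intro mult_right_mono) (auto simp: gap_weight_def)
    then show "gap_weight t (Suc k) * (1 - ?b) \<le> gap_weight t (Suc k) - 2 * ?p * ?b"
      by (simp add: algebra_simps)
    show "0 \<le> (1 - ?b) * (1 - ?p)" using b p by simp
  qed
  finally show ?thesis .
qed

text \<open>Here \<open>a\<close> is the scaled expected gap, \<open>d\<close> and \<open>e\<close> are the expected squared distances of
  \<open>x\<^sub>k\<close> and \<open>z\<^sub>k\<close> from the minimizer, \<open>U\<close> is that between \<open>x\<^sub>k\<close> and \<open>z\<^sub>k\<close>, \<open>N\<close> is the expected
  squared length of the full step from \<open>z\<^sub>k\<close>, and \<open>M\<close> its correlation with \<open>x\<^sub>k - z\<^sub>k\<close>.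
  Hypothesis \<open>optimal\<close> compares a step with the minimizer and gives the classical bound
  $e_{k+1} + a_{k+1}/\theta_k^2 \le R$. Hypothesis \<open>energy\<close> compares it with the current point
  and says that the gap grows at most by $\theta_k^2$ times the decrease of the squared distance from the
  second iterate to \<open>x\<^sub>k\<close>.
  The convexity defect of $d$ in \<open>d_step\<close> is the discrete form of the kinetic energy, and a fraction of
  it is stored in the term \<open>spread_weight\<close> of the inequality proved by induction.\<close>

lemma accelerated_sequence_bound:
  fixes a d e U M N :: "nat \<Rightarrow> real" and t R :: real
  defines "\<theta> \<equiv> theta t" and "q \<equiv> \<lambda>k. theta t k / t"
  assumes t: "0 < t" "t \<le> 1"
    and a: "\<And>k. a k \<ge> 0" and U: "\<And>k. U k \<ge> 0" and N: "\<And>k. N k \<ge> 0"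
    and start: "d 1 = e 1" "U 1 = 0"
    and R: "R = (1 - t) / t\<^sup>2 * a 0 + e 0"
    and optimal: "\<And>k. a (Suc k) + (\<theta> k)\<^sup>2 * e (Suc k) \<le> (1 - \<theta> k) * a k + (\<theta> k)\<^sup>2 * e k"
    and energy: "\<And>k. a (Suc k) \<le> a k + (\<theta> k)\<^sup>2 * t * (2 * M k - N k)"
    and d_step: "\<And>k. d (Suc k) = (1 - \<theta> k) * d k - (q k - \<theta> k) * e k + q k * e (Suc k)
        - \<theta> k * ((1 - \<theta> k) * (U k - 2 * M k + N k) - (q k - \<theta> k) * N k)"
    and U_step: "\<And>k. U (Suc k) = (1 - \<theta> k)\<^sup>2 * U k - 2 * t * (1 - \<theta> k) * (1 - q k) * M k
        + t * (1 - q k)\<^sup>2 * N k"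
  shows "d (Suc k) + a (Suc k) / (2 * (\<theta> k)\<^sup>2) \<le> R"
proof -
  have th: "0 < \<theta> k" "\<theta> k \<le> t" "\<theta> (Suc k) < 1"
      "(\<theta> (Suc k))\<^sup>2 = (1 - \<theta> (Suc k)) * (\<theta> k)\<^sup>2" for k
    unfolding \<theta>_def
    using theta_pos[OF t(1)] theta_le_start[OF t(1)] theta_Suc_less_one[OF t(1)]
      theta_recurrence(2)[OF t(1)] by blast+
  have th_t: "\<theta> k = t * q k" for k using t by (simp add: q_def \<theta>_def)
  have q: "0 < q k" "q k \<le> 1" "\<theta> k \<le> q k" for k
    using th[of k] t by (auto simp: q_def \<theta>_def[symmetric] field_simps)
  have classical: "e (Suc k) + a (Suc k) / (\<theta> k)\<^sup>2 \<le> R" for k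
  proof (induction k)
    case 0
    have "\<theta> 0 = t" by (simp add: \<theta>_def)
    then have "(a 1 + t\<^sup>2 * e 1) / t\<^sup>2 \<le> ((1 - t) * a 0 + t\<^sup>2 * e 0) / t\<^sup>2"
      using optimal[of 0] by (simp add: divide_right_mono)
    then show ?case using t \<open>\<theta> 0 = t\<close> by (simp add: R add_divide_distrib)
  next
    case (Suc k)
    let ?s = "\<theta> (Suc k)"
    have "(a (Suc (Suc k)) + ?s\<^sup>2 * e (Suc (Suc k))) / ?s\<^sup>2
        \<le> ((1 - ?s) * a (Suc k) + ?s\<^sup>2 * e (Suc k)) / ?s\<^sup>2"
      using optimal[of "Suc k"] by (simp add: divide_right_mono)
    then have "a (Suc (Suc k)) / ?s\<^sup>2 + e (Suc (Suc k)) \<le> ((1 - ?s) * a (Suc k) + ?s\<^sup>2 * e (Suc k)) / ?s\<^sup>2"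
      using th(1)[of "Suc k"] by (simp add: add_divide_distrib)
    also have "\<dots> = (1 - ?s) / ?s\<^sup>2 * a (Suc k) + e (Suc k)"
      using th(1)[of "Suc k"] by (simp add: field_simps)
    also have "(1 - ?s) / ?s\<^sup>2 = 1 / (\<theta> k)\<^sup>2"
      unfolding th(4) using th(3)[of k] by simp
    finally show ?case using Suc by simp
  qed
  have lyapunov: "d (Suc k) + gap_weight t k / (2 * (\<theta> k)\<^sup>2) * a (Suc k) + spread_weight t k / 2 * U (Suc k) \<le> R"
    for k
  proof (induction k)
    case 0
    then show ?case using classical[of 0] start t by (simp add: gap_weight_def \<theta>_def)
  next
    case (Suc j)
    let ?k = "Suc j"
    define s where "s = \<theta> ?k"
    define p where "p = q ?k"
    define c where "c = gap_weight t ?k"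
    define n where "n = spread_weight t ?k"
    define b where "b = 1 / s\<^sup>2"
    \<comment> \<open>the part of the gap weight that only the energy inequality can pay for\<close>
    define m where "m = c - 2 * p"
    have s: "0 < s" "s < 1" using th[of ?k] th(3)[of j] by (auto simp: s_def)
    have p: "0 < p" "p < 1" "s \<le> p" "s = t * p"
    proof -
      show "0 < p" "s \<le> p" using q[of ?k] by (auto simp: p_def s_def)
      show st: "s = t * p" using th_t by (simp add: s_def p_def)
      have "s < t" using theta_Suc_less_start[OF t(1)] by (simp add: s_def \<theta>_def)
      then show "p < 1" using st t by simp
    qed
    have m: "0 \<le> m" by (simp add: m_def c_def gap_weight_def p_def q_def)
    have b: "0 < b" and b': "1 / (\<theta> j)\<^sup>2 = (1 - s) * b"
    proof -
      show "0 < b" using s by (simp add: b_def)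
      have "s\<^sup>2 = (1 - s) * (\<theta> j)\<^sup>2" using th(4) by (simp add: s_def)
      then show "1 / (\<theta> j)\<^sup>2 = (1 - s) * b"
        using s th(1)[of j] by (simp add: b_def)
    qed
    have n: "n * ((1 - s) * (1 - p)) = 2 * p * (1 - s) + m"
    proof -
      have "n = (c - 2 * p * s) / ((1 - s) * (1 - p))"
        by (simp add: n_def spread_weight_def c_def s_def p_def \<theta>_def q_def)
      then have "n * ((1 - s) * (1 - p)) = c - 2 * p * s" using s p by simp
      then show ?thesis by (simp add: m_def algebra_simps)
    qed
    have IH: "d ?k \<le> R - gap_weight t j / 2 * (1 - s) * b * a ?k - spread_weight t j / 2 * U ?k"
    proof -
      have coeff: "gap_weight t j / (2 * (\<theta> j)\<^sup>2) = gap_weight t j / 2 * ((1 - s) * b)"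
        unfolding b'[symmetric] by simp
      show ?thesis using Suc unfolding coeff by (simp add: mult.assoc)
    qed
    have e_bound: "e ?k \<le> R - (1 - s) * b * a ?k"
    proof -
      have coeff: "a ?k / (\<theta> j)\<^sup>2 = (1 - s) * b * a ?k"
        unfolding b'[symmetric] by simp
      show ?thesis using classical[of j] unfolding coeff by simp
    qed
    have opt: "e (Suc ?k) \<le> e ?k + (1 - s) * b * a ?k - b * a (Suc ?k)"
    proof -
      have "b * (a (Suc ?k) + s\<^sup>2 * e (Suc ?k)) \<le> b * ((1 - s) * a ?k + s\<^sup>2 * e ?k)"
        using optimal[of ?k] b by (intro mult_left_mono) (auto simp: s_def)
      moreover have "b * (A + s\<^sup>2 * B) = b * A + B" for A B
      proof -
        have "b * (A + s\<^sup>2 * B) = b * A + (b * s\<^sup>2) * B" by (simp add: algebra_simps)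
        also have "b * s\<^sup>2 = 1" using s by (simp add: b_def)
        finally show ?thesis by simp
      qed
      ultimately show ?thesis by (simp add: ac_simps)
    qed
    have en: "b * a (Suc ?k) \<le> b * a ?k + t * (2 * M ?k - N ?k)"
    proof -
      have "b * a (Suc ?k) \<le> b * (a ?k + s\<^sup>2 * t * (2 * M ?k - N ?k))"
        using energy[of ?k] b by (intro mult_left_mono) (auto simp: s_def)
      also have "\<dots> = b * a ?k + (b * s\<^sup>2) * (t * (2 * M ?k - N ?k))" by (simp add: algebra_simps)
      also have "b * s\<^sup>2 = 1" using s by (simp add: b_def)
      finally show ?thesis by simp
    qed
    \<comment> \<open>It remains to check that, after substituting the induction hypothesis and the bounds
      above, the coefficients of \<open>a\<close>, \<open>U\<close> and \<open>N\<close> have the right sign; that of \<open>M\<close> is zero by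
      the choice of \<open>spread_weight\<close>.\<close>
    have a_coeff: "m + 2 * (p - s) * (1 - s) \<le> (1 - s)\<^sup>2 * gap_weight t j"
    proof (cases "1 \<le> 2 * p")
      case True
      have "p - s \<le> (1 - s) * q j"
        using theta_weight_nonneg[OF t, of j] by (simp add: p_def s_def q_def \<theta>_def)
      then have "2 * (p - s) * (1 - s) \<le> (1 - s)\<^sup>2 * (2 * q j)"
        using s mult_right_mono[of "p - s" "(1 - s) * q j" "2 * (1 - s)"]
        by (simp add: power2_eq_square algebra_simps)
      also have "\<dots> \<le> (1 - s)\<^sup>2 * gap_weight t j"
        by (intro mult_left_mono) (auto simp: gap_weight_def q_def)
      finally show ?thesis using True by (simp add: m_def c_def gap_weight_def p_def q_def)
    next
      case False
      then have "m = 1 - 2 * p" by (simp add: m_def c_def gap_weight_def p_def q_def)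
      moreover have "s * s \<le> 2 * p * s" using p(1,3) s by (intro mult_right_mono) linarith+
      ultimately have "m + 2 * (p - s) * (1 - s) \<le> (1 - s)\<^sup>2 * 1"
        by (simp add: power2_eq_square algebra_simps)
      also have "\<dots> \<le> (1 - s)\<^sup>2 * gap_weight t j"
        by (intro mult_left_mono) (auto simp: gap_weight_def)
      finally show ?thesis .
    qed
    have U_coeff: "n * (1 - s) * U ?k \<le> spread_weight t j * U ?k"
    proof (cases j)
      case 0
      then show ?thesis using start by simp
    next
      case (Suc i)
      then show ?thesis
        using spread_weight_decreasing[OF t, of i] U[of ?k]
        by (intro mult_right_mono) (auto simp: n_def s_def \<theta>_def)
    qed
    have N_coeff: "n * t * (1 - p)\<^sup>2 \<le> 2 * s * (1 - p) + m * t"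
    proof -
      have "n * t * (1 - p)\<^sup>2 = t * (1 - p) * (2 * p * (1 - s) + m) / (1 - s)"
        unfolding n[symmetric] using s by (simp add: power2_eq_square)
      also have "\<dots> = t * (1 - p) * ((2 * p * (1 - s) + m) / (1 - s))" by simp
      also have "(2 * p * (1 - s) + m) / (1 - s) = 2 * p + m / (1 - s)"
        using s by (simp add: add_divide_distrib)
      also have "t * (1 - p) * (2 * p + m / (1 - s)) = 2 * (t * p) * (1 - p) + m * t * ((1 - p) / (1 - s))"
        unfolding distrib_left by (simp add: ac_simps)
      also have "\<dots> = 2 * s * (1 - p) + m * t * ((1 - p) / (1 - s))"
        unfolding p(4)[symmetric] ..
      also have "\<dots> \<le> 2 * s * (1 - p) + m * t * 1"
      proof (intro add_left_mono mult_left_mono)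
        show "(1 - p) / (1 - s) \<le> 1" using s p(3) by simp
        show "0 \<le> m * t" using m t by simp
      qed
      finally show ?thesis by simp
    qed
    have "d (Suc ?k) = (1 - s) * d ?k - (p - s) * e ?k + p * e (Suc ?k)
        - s * ((1 - s) * (U ?k - 2 * M ?k + N ?k) - (p - s) * N ?k)"
      using d_step[of ?k] by (simp add: s_def p_def)
    also have "\<dots> \<le> (1 - s) * d ?k + s * e ?k + p * ((1 - s) * b * a ?k - b * a (Suc ?k))
        - s * ((1 - s) * (U ?k - 2 * M ?k + N ?k) - (p - s) * N ?k)"
      using mult_left_mono[OF opt, of p] p by (simp add: algebra_simps)
    also have "\<dots> \<le> (1 - s) * (R - gap_weight t j / 2 * (1 - s) * b * a ?k - spread_weight t j / 2 * U ?k)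
        + s * (R - (1 - s) * b * a ?k) + p * ((1 - s) * b * a ?k - b * a (Suc ?k))
        - s * ((1 - s) * (U ?k - 2 * M ?k + N ?k) - (p - s) * N ?k)"
    proof -
      have "(1 - s) * d ?k \<le> (1 - s) * (R - gap_weight t j / 2 * (1 - s) * b * a ?k
          - spread_weight t j / 2 * U ?k)"
        by (rule mult_left_mono[OF IH]) (use s in simp)
      moreover have "s * e ?k \<le> s * (R - (1 - s) * b * a ?k)"
        by (rule mult_left_mono[OF e_bound]) (use s in simp)
      ultimately show ?thesis by linarith
    qed
    finally have main: "d (Suc ?k) \<le> \<dots>" .
    have en': "m / 2 * (b * a (Suc ?k)) \<le> m / 2 * (b * a ?k + t * (2 * M ?k - N ?k))"
      using en m by (intro mult_left_mono) auto
    have Ust: "U (Suc ?k) = (1 - s)\<^sup>2 * U ?k - 2 * t * (1 - s) * (1 - p) * M ?k + t * (1 - p)\<^sup>2 * N ?k"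
      using U_step[of ?k] by (simp add: s_def p_def)
    have nU: "n / 2 * U (Suc ?k) = (1 - s) / 2 * (n * (1 - s) * U ?k) - t * (2 * p * (1 - s) + m) * M ?k
        + n * t * (1 - p)\<^sup>2 / 2 * N ?k"
      unfolding Ust n[symmetric] by (simp add: power2_eq_square algebra_simps add_divide_distrib diff_divide_distrib)
    have 1: "(1 - s) / 2 * (n * (1 - s) * U ?k) \<le> (1 - s) / 2 * (spread_weight t j * U ?k)"
      using U_coeff s by (intro mult_left_mono) auto
    have 2: "n * t * (1 - p)\<^sup>2 / 2 * N ?k \<le> (2 * s * (1 - p) + m * t) / 2 * N ?k"
      using N_coeff N[of ?k] by (intro mult_right_mono) auto
    have 3: "b / 2 * a ?k * (m + 2 * (p - s) * (1 - s)) \<le> b / 2 * a ?k * ((1 - s)\<^sup>2 * gap_weight t j)"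
      using a_coeff b a[of ?k] by (intro mult_left_mono) auto
    have 4: "0 \<le> s * (1 - s) * U ?k" using s U[of ?k] by simp
    have "d (Suc ?k) + (m / 2 + p) * (b * a (Suc ?k)) + n / 2 * U (Suc ?k) \<le> R"
    proof -
      have main': "d (Suc ?k) \<le> R - b / 2 * a ?k * ((1 - s)\<^sup>2 * gap_weight t j)
          - (1 - s) / 2 * (spread_weight t j * U ?k) + b / 2 * a ?k * (2 * (p - s) * (1 - s))
          - p * (b * a (Suc ?k)) - s * (1 - s) * U ?k + 2 * (s * (1 - s) * M ?k) - s * (1 - p) * N ?k"
        using main by (simp add: power2_eq_square algebra_simps add_divide_distrib diff_divide_distrib)
      have en2: "m / 2 * (b * a (Suc ?k)) \<le> b / 2 * a ?k * m + m * t * M ?k - m * t / 2 * N ?k"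
        using en' by (simp add: algebra_simps add_divide_distrib diff_divide_distrib)
      have nU': "n / 2 * U (Suc ?k) = (1 - s) / 2 * (n * (1 - s) * U ?k) - 2 * (s * (1 - s) * M ?k)
          - m * t * M ?k + n * t * (1 - p)\<^sup>2 / 2 * N ?k"
        unfolding nU by (simp add: p(4) algebra_simps add_divide_distrib diff_divide_distrib)
      have split_N: "(2 * s * (1 - p) + m * t) / 2 * N ?k = s * (1 - p) * N ?k + m * t / 2 * N ?k"
        by (simp add: algebra_simps add_divide_distrib diff_divide_distrib)
      have split_a: "b / 2 * a ?k * (m + 2 * (p - s) * (1 - s))
          = b / 2 * a ?k * m + b / 2 * a ?k * (2 * (p - s) * (1 - s))"
        by (rule distrib_left)
      have "(m / 2 + p) * (b * a (Suc ?k)) = m / 2 * (b * a (Suc ?k)) + p * (b * a (Suc ?k))"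
        by (rule distrib_right)
      then show ?thesis using main' en2 nU' 1 2 split_N 3 split_a 4 by linarith
    qed
    moreover have "gap_weight t ?k / (2 * (\<theta> ?k)\<^sup>2) = (m / 2 + p) * b"
      by (simp add: m_def c_def b_def s_def field_simps)
    ultimately show ?case by (simp add: n_def mult.assoc)
  qed
  have spread: "0 \<le> spread_weight t k"
  proof -
    have "2 * q k * \<theta> k \<le> 2 * q k * 1"
      using q[of k] th(2)[of k] t by (intro mult_left_mono) auto
    then show ?thesis
      unfolding spread_weight_def using q[of k] th(2)[of k] t
      by (intro divide_nonneg_nonneg mult_nonneg_nonneg) (auto simp: gap_weight_def q_def \<theta>_def)
  qed
  have "a (Suc k) / (2 * (\<theta> k)\<^sup>2) \<le> gap_weight t k / (2 * (\<theta> k)\<^sup>2) * a (Suc k)"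
    using a[of "Suc k"] th(1)[of k]
      mult_right_mono[of 1 "gap_weight t k" "a (Suc k) / (2 * (\<theta> k)\<^sup>2)"]
    by (simp add: gap_weight_def)
  moreover have "0 \<le> spread_weight t k / 2 * U (Suc k)"
    using spread U[of "Suc k"] by simp
  ultimately show ?thesis using lyapunov[of k] by linarith
qed

section \<open>One-dimensional proximal steps and the gradient inequality\<close>

definition eff_domain :: "(real \<Rightarrow> ereal) \<Rightarrow> real set" where
  "eff_domain g = {u. g u < \<infinity>}"

lemma closed_proper_convex_ereal:
  assumes "closed_proper_convex g" "u \<in> eff_domain g"
  shows "ereal (real_of_ereal (g u)) = g u"
  using assms by (auto simp: closed_proper_convex_def eff_domain_def intro!: ereal_real')

lemma epigraph_iff:
  assumes "closed_proper_convex g"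
  shows "(u, s) \<in> ereal_epigraph g \<longleftrightarrow> u \<in> eff_domain g \<and> real_of_ereal (g u) \<le> s"
proof
  assume L: "(u, s) \<in> ereal_epigraph g"
  then have "g u \<le> ereal s" by (simp add: ereal_epigraph_def)
  then have dom: "u \<in> eff_domain g" by (auto simp: eff_domain_def intro: le_less_trans)
  with \<open>g u \<le> ereal s\<close> closed_proper_convex_ereal[OF assms dom]
  show "u \<in> eff_domain g \<and> real_of_ereal (g u) \<le> s"
    by (metis ereal_less_eq(3))
next
  assume "u \<in> eff_domain g \<and> real_of_ereal (g u) \<le> s"
  then show "(u, s) \<in> ereal_epigraph g"
    using closed_proper_convex_ereal[OF assms, of u] by (metis (mono_tags, lifting) case_prod_conv ereal_epigraph_def ereal_less_eq(3) mem_Collect_eq)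
qed

lemma closed_proper_convex_real_convex:
  assumes "closed_proper_convex g"
  shows "convex_on (eff_domain g) (\<lambda>u. real_of_ereal (g u))"
proof -
  let ?r = "\<lambda>u. real_of_ereal (g u)"
  have C: "convex (ereal_epigraph g)" using assms by (simp add: closed_proper_convex_def)
  have *: "(1 - s) * u + s * w \<in> eff_domain g \<and> ?r ((1 - s) * u + s * w) \<le> (1 - s) * ?r u + s * ?r w"
    if "0 \<le> s" "s \<le> 1" "u \<in> eff_domain g" "w \<in> eff_domain g" for s u w
  proof -
    have "(u, ?r u) \<in> ereal_epigraph g" "(w, ?r w) \<in> ereal_epigraph g"
      using that by (auto simp: epigraph_iff[OF assms])
    then have "(1 - s) *\<^sub>R (u, ?r u) + s *\<^sub>R (w, ?r w) \<in> ereal_epigraph g"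
      using that by (intro convexD[OF C]) auto
    then show ?thesis by (simp add: epigraph_iff[OF assms])
  qed
  show ?thesis
  proof (rule convex_onI)
    show "convex (eff_domain g)"
      unfolding convex_alt using * by (metis real_scaleR_def)
  qed (use * in auto)
qed

text \<open>A point directly below the epigraph can be separated from it strictly. The separating line is not
  vertical, because it separates two points on the same vertical line.\<close>

lemma affine_minorant:
  assumes "closed_proper_convex g"
  obtains \<alpha> \<beta> where "\<And>u s. (u, s) \<in> ereal_epigraph g \<Longrightarrow> \<alpha> + \<beta> * u \<le> s"
proof -
  obtain u0 where u0: "g u0 \<noteq> \<infinity>" using assms by (auto simp: closed_proper_convex_def)
  define t0 where "t0 = real_of_ereal (g u0)"
  have in0: "(u0, t0) \<in> ereal_epigraph g" and out: "(u0, t0 - 1) \<notin> ereal_epigraph g"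
    using u0 by (auto simp: epigraph_iff[OF assms] t0_def eff_domain_def)
  then obtain p b where p: "inner p (u0, t0 - 1) < b" "\<And>x. x \<in> ereal_epigraph g \<Longrightarrow> inner p x > b"
    using separating_hyperplane_closed_point[OF _ _ out] assms
    unfolding closed_proper_convex_def by blast
  obtain p1 p2 where pp: "p = (p1, p2)" by fastforce
  have "p2 > 0" using p(1) p(2)[OF in0] by (auto simp: pp algebra_simps)
  show ?thesis
  proof (rule that[of "b / p2" "- p1 / p2"])
    fix u s assume "(u, s) \<in> ereal_epigraph g"
    then show "b / p2 + - p1 / p2 * u \<le> s"
      using p(2)[of "(u, s)"] \<open>p2 > 0\<close> by (simp add: pp field_simps)
  qed
qed

text \<open>Minimizing over the epigraph makes the objective continuous. The quadratic term dominates the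
  affine minorant, so the sublevel sets in the epigraph are compact.\<close>

lemma prox_minimizer_exists:
  assumes g: "closed_proper_convex g" and c: "c > 0"
  obtains m where "m \<in> eff_domain g"
    "\<And>u. ereal (l * (m - y) + c * \<bar>m - z\<bar>\<^sup>2) + g m \<le> ereal (l * (u - y) + c * \<bar>u - z\<bar>\<^sup>2) + g u"
proof -
  define \<phi> where "\<phi> = (\<lambda>(u, s). l * (u - y) + c * (u - z)\<^sup>2 + s :: real)"
  obtain \<alpha> \<beta> where minor: "\<And>u s. (u, s) \<in> ereal_epigraph g \<Longrightarrow> \<alpha> + \<beta> * u \<le> s"
    using affine_minorant[OF g] by metis
  obtain u0 where u0: "u0 \<in> eff_domain g" using g by (auto simp: closed_proper_convex_def eff_domain_def)
  define t0 where "t0 = real_of_ereal (g u0)"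
  have in0: "(u0, t0) \<in> ereal_epigraph g" using u0 by (simp add: epigraph_iff[OF g] t0_def)
  define h where "h = \<phi> (u0, t0)"
  define S where "S = ereal_epigraph g \<inter> {x. \<phi> x \<le> h}"
  define k where "k = l + \<beta>"
  define r where "r = h + l * y - \<alpha> - k * z"
  have cont: "continuous_on A \<phi>" for A
    unfolding \<phi>_def case_prod_unfold by (intro continuous_intros)
  have "closed S"
    unfolding S_def using g by (intro closed_Int closed_Collect_le cont continuous_on_const)
      (simp add: closed_proper_convex_def)
  moreover have "bounded S"
  proof -
    \<comment> \<open>beyond distance \<open>q\<close> the quadratic exceeds the linear term by more than \<open>\<bar>r\<bar>\<close>\<close>
    define q where "q = (\<bar>k\<bar> + \<bar>r\<bar>) / c + 1"
    have u_bound: "\<bar>u - z\<bar> \<le> q" if "(u, s) \<in> S" for u s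
    proof (rule ccontr)
      assume far: "\<not> \<bar>u - z\<bar> \<le> q"
      have "l * (u - y) + c * (u - z)\<^sup>2 + (\<alpha> + \<beta> * u) \<le> h"
        using that minor[of u s] by (auto simp: S_def \<phi>_def)
      then have "c * (u - z)\<^sup>2 + k * (u - z) \<le> r"
        by (simp add: k_def r_def algebra_simps)
      moreover have "- (\<bar>k\<bar> * \<bar>u - z\<bar>) \<le> k * (u - z)"
        by (metis abs_ge_minus_self abs_mult minus_le_iff)
      ultimately have ub: "c * \<bar>u - z\<bar>\<^sup>2 - \<bar>k\<bar> * \<bar>u - z\<bar> \<le> \<bar>r\<bar>" by simp
      have q1: "q \<ge> 1" using c by (simp add: q_def)
      have "\<bar>r\<bar> < (c * q - \<bar>k\<bar>) * 1" using c by (simp add: q_def field_simps)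
      also have "\<dots> \<le> (c * \<bar>u - z\<bar> - \<bar>k\<bar>) * \<bar>u - z\<bar>"
      proof (rule mult_mono)
        show "c * q - \<bar>k\<bar> \<le> c * \<bar>u - z\<bar> - \<bar>k\<bar>" using far c by simp
        show "0 \<le> c * \<bar>u - z\<bar> - \<bar>k\<bar>"
        proof -
          have "\<bar>k\<bar> \<le> c * q" using c by (simp add: q_def field_simps)
          also have "\<dots> \<le> c * \<bar>u - z\<bar>" using far c by simp
          finally show ?thesis by simp
        qed
      qed (use far q1 in auto)
      finally show False using ub by (simp add: power2_eq_square algebra_simps)
    qed
    have s_bound: "\<bar>s\<bar> \<le> \<bar>h\<bar> + \<bar>l\<bar> * (q + \<bar>z\<bar> + \<bar>y\<bar>) + \<bar>\<alpha>\<bar> + \<bar>\<beta>\<bar> * (q + \<bar>z\<bar>)" if "(u, s) \<in> S" for u s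
    proof -
      have uq: "\<bar>u\<bar> \<le> q + \<bar>z\<bar>" using u_bound[OF that] by linarith
      have "\<bar>\<beta> * u\<bar> \<le> \<bar>\<beta>\<bar> * (q + \<bar>z\<bar>)" "\<bar>l * (u - y)\<bar> \<le> \<bar>l\<bar> * (q + \<bar>z\<bar> + \<bar>y\<bar>)"
        unfolding abs_mult using uq by (auto intro!: mult_left_mono)
      moreover have "\<alpha> + \<beta> * u \<le> s" "l * (u - y) + c * (u - z)\<^sup>2 + s \<le> h" "0 \<le> c * (u - z)\<^sup>2"
        using that minor[of u s] c by (auto simp: S_def \<phi>_def)
      ultimately show ?thesis by linarith
    qed
    have "S \<subseteq> {z - q..z + q} \<times> {- (\<bar>h\<bar> + \<bar>l\<bar> * (q + \<bar>z\<bar> + \<bar>y\<bar>) + \<bar>\<alpha>\<bar> + \<bar>\<beta>\<bar> * (q + \<bar>z\<bar>))..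
        \<bar>h\<bar> + \<bar>l\<bar> * (q + \<bar>z\<bar> + \<bar>y\<bar>) + \<bar>\<alpha>\<bar> + \<bar>\<beta>\<bar> * (q + \<bar>z\<bar>)}"
      using u_bound s_bound by (fastforce simp: abs_le_iff)
    then show ?thesis
      by (rule bounded_subset[rotated]) (intro bounded_Times bounded_closed_interval)
  qed
  ultimately have "compact S" by (simp add: compact_eq_bounded_closed)
  moreover have "(u0, t0) \<in> S" using in0 by (simp add: S_def h_def)
  ultimately obtain w where w: "w \<in> S" "\<And>x. x \<in> S \<Longrightarrow> \<phi> w \<le> \<phi> x"
    using continuous_attains_inf[OF _ _ cont, of S] by blast
  then have glob: "\<phi> w \<le> \<phi> x" if "x \<in> ereal_epigraph g" for x
    using that by (cases "\<phi> x \<le> h") (auto simp: S_def)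
  obtain m s where ms: "w = (m, s)" by fastforce
  have m: "m \<in> eff_domain g" "real_of_ereal (g m) \<le> s"
    using w(1) ms by (auto simp: S_def epigraph_iff[OF g])
  show ?thesis
  proof (rule that[OF m(1)])
    fix u
    show "ereal (l * (m - y) + c * \<bar>m - z\<bar>\<^sup>2) + g m \<le> ereal (l * (u - y) + c * \<bar>u - z\<bar>\<^sup>2) + g u"
    proof (cases "u \<in> eff_domain g")
      case True
      then have "(u, real_of_ereal (g u)) \<in> ereal_epigraph g" by (simp add: epigraph_iff[OF g])
      from glob[OF this] m(2)
      have "l * (m - y) + c * \<bar>m - z\<bar>\<^sup>2 + real_of_ereal (g m) \<le> l * (u - y) + c * \<bar>u - z\<bar>\<^sup>2 + real_of_ereal (g u)"
        by (simp add: \<phi>_def ms)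
      then have "ereal (l * (m - y) + c * \<bar>m - z\<bar>\<^sup>2) + ereal (real_of_ereal (g m))
          \<le> ereal (l * (u - y) + c * \<bar>u - z\<bar>\<^sup>2) + ereal (real_of_ereal (g u))" by simp
      then show ?thesis
        unfolding closed_proper_convex_ereal[OF g True] closed_proper_convex_ereal[OF g m(1)] .
    qed (simp add: eff_domain_def)
  qed
qed

text \<open>The minimized function is strongly convex: comparing the minimizer \<open>m\<close> with the points of the
  segment from \<open>m\<close> to \<open>u\<close> at parameter \<open>s\<close> gains the quadratic term up to a factor \<open>1 - s\<close>, which
  disappears in the limit.\<close>

lemma prox_three_point:
  fixes l y c z u :: real and g :: "real \<Rightarrow> ereal"
  defines "m \<equiv> arg_min (\<lambda>u. ereal (l * (u - y) + c * \<bar>u - z\<bar>\<^sup>2) + g u) (\<lambda>_. True)"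
  assumes g: "closed_proper_convex g" and c: "c > 0"
  shows "m \<in> eff_domain g"
    and "u \<in> eff_domain g \<Longrightarrow>
      l * (m - y) + c * (m - z)\<^sup>2 + real_of_ereal (g m) + c * (u - m)\<^sup>2
        \<le> l * (u - y) + c * (u - z)\<^sup>2 + real_of_ereal (g u)"
proof -
  let ?\<phi> = "\<lambda>u. ereal (l * (u - y) + c * \<bar>u - z\<bar>\<^sup>2) + g u"
  let ?r = "\<lambda>u. real_of_ereal (g u)"
  obtain m0 where m0: "m0 \<in> eff_domain g" "\<And>u. ?\<phi> m0 \<le> ?\<phi> u"
    using prox_minimizer_exists[OF g c, of l y z] by metis
  have min: "?\<phi> m \<le> ?\<phi> u" for u
    unfolding m_def
  proof (rule arg_minI[where f = ?\<phi> and P = "\<lambda>_. True" and x = m0])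
    fix x assume x: "\<forall>y. True \<longrightarrow> \<not> ?\<phi> y < ?\<phi> x"
    then show "?\<phi> x \<le> ?\<phi> u" by (simp add: not_less)
  qed (use m0 in \<open>auto simp: not_less\<close>)
  have "?\<phi> m0 < \<infinity>"
    using m0(1) by (cases "g m0") (auto simp: eff_domain_def)
  then have "?\<phi> m < \<infinity>" using min[of m0] by (rule le_less_trans[rotated])
  then show m: "m \<in> eff_domain g" by (cases "g m") (auto simp: eff_domain_def)
  assume u: "u \<in> eff_domain g"
  have min_real: "l * (m - y) + c * (m - z)\<^sup>2 + ?r m \<le> l * (w - y) + c * (w - z)\<^sup>2 + ?r w"
    if "w \<in> eff_domain g" for w
  proof -
    have "ereal (l * (m - y) + c * \<bar>m - z\<bar>\<^sup>2 + ?r m) \<le> ereal (l * (w - y) + c * \<bar>w - z\<bar>\<^sup>2 + ?r w)"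
      using min[of w] closed_proper_convex_ereal[OF g m] closed_proper_convex_ereal[OF g that]
      by (metis plus_ereal.simps(1))
    then show ?thesis by simp
  qed
  let ?A = "l * (m - y) + c * (m - z)\<^sup>2 + ?r m" and ?B = "l * (u - y) + c * (u - z)\<^sup>2 + ?r u"
  have part: "?A + c * (1 - s) * (u - m)\<^sup>2 \<le> ?B" if s: "0 < s" "s < 1" for s
  proof -
    let ?w = "(1 - s) * m + s * u"
    note conv = closed_proper_convex_real_convex[OF g]
    have w: "?w \<in> eff_domain g"
      using convexD[OF convex_on_imp_convex[OF conv] m u, of "1 - s" s] s by simp
    have rw: "?r ?w \<le> (1 - s) * ?r m + s * ?r u"
      using convex_onD[OF conv, of s m u] s m u by simp
    have "?A \<le> l * (?w - y) + c * (?w - z)\<^sup>2 + ((1 - s) * ?r m + s * ?r u)"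
      using min_real[OF w] rw by linarith
    also have "\<dots> = (1 - s) * ?A + s * ?B - s * (c * (1 - s) * (u - m)\<^sup>2)"
      by (simp add: power2_eq_square algebra_simps)
    finally have "s * (?A + c * (1 - s) * (u - m)\<^sup>2) \<le> s * ?B"
      by (simp add: algebra_simps)
    then show ?thesis using s by (metis mult_le_cancel_left_pos)
  qed
  have "((\<lambda>s. ?A + c * (1 - s) * (u - m)\<^sup>2) \<longlongrightarrow> ?A + c * (1 - 0) * (u - m)\<^sup>2) (at_right 0)"
    by (intro tendsto_intros)
  moreover have "\<forall>\<^sub>F s in at_right 0. ?A + c * (1 - s) * (u - m)\<^sup>2 \<le> ?B"
    using part by (auto simp: eventually_at_right[of 0 1] intro!: exI[of _ 1])
  ultimately have "?A + c * (1 - 0) * (u - m)\<^sup>2 \<le> ?B"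
    by (rule tendsto_upperbound) simp
  then show "?A + c * (u - m)\<^sup>2 \<le> ?B" by simp
qed

lemma convex_gradient_inequality:
  fixes f :: "'a::real_inner \<Rightarrow> real"
  assumes f: "convex_on UNIV f" and g: "GDERIV f y :> g"
  shows "f y + inner g (u - y) \<le> f u"
proof -
  define \<phi> where "\<phi> = (\<lambda>t::real. f (y + t *\<^sub>R (u - y)))"
  have conv: "convex_on UNIV \<phi>"
  proof (rule convex_onI)
    fix t a b :: real assume t: "0 < t" "t < 1"
    have "y + ((1 - t) *\<^sub>R a + t *\<^sub>R b) *\<^sub>R (u - y)
        = (1 - t) *\<^sub>R (y + a *\<^sub>R (u - y)) + t *\<^sub>R (y + b *\<^sub>R (u - y))"
      by (simp add: algebra_simps)
    then show "\<phi> ((1 - t) *\<^sub>R a + t *\<^sub>R b) \<le> (1 - t) * \<phi> a + t * \<phi> b"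
      unfolding \<phi>_def using convex_onD[OF f, of t] t by simp
  qed simp
  have fd: "(f has_derivative (\<lambda>h. inner h g)) (at y)" using g by (simp add: gderiv_def)
  have line: "((\<lambda>t::real. y + t *\<^sub>R (u - y)) has_derivative (\<lambda>t. t *\<^sub>R (u - y))) (at 0)"
    by (auto intro!: derivative_eq_intros)
  have "(\<phi> has_derivative (\<lambda>t. inner (t *\<^sub>R (u - y)) g)) (at 0)"
    unfolding \<phi>_def using has_derivative_compose[OF line, of f "\<lambda>h. inner h g"] fd by simp
  then have "(\<phi> has_real_derivative inner (u - y) g) (at 0)"
    by (simp add: has_field_derivative_def mult_commute_abs)
  from convex_on_imp_above_tangent[OF conv _ _ _ this, of 1]
  show ?thesis by (simp add: \<phi>_def inner_commute)
qed

section \<open>Expectations over a uniform sampling\<close>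

lemma expectation_finite_mono:
  fixes g h :: "'a \<Rightarrow> real"
  assumes "finite (set_pmf p)" "\<And>s. s \<in> set_pmf p \<Longrightarrow> g s \<le> h s"
  shows "measure_pmf.expectation p g \<le> measure_pmf.expectation p h"
  using assms by (intro integral_mono_AE integrable_measure_pmf_finite) (auto simp: AE_measure_pmf_iff)

lemma expectation_bind_finite:
  fixes h :: "'b \<Rightarrow> real"
  assumes "finite (set_pmf p)" "\<And>s. s \<in> set_pmf p \<Longrightarrow> finite (set_pmf (k s))"
  shows "measure_pmf.expectation (p \<bind> k) h
    = measure_pmf.expectation p (\<lambda>s. measure_pmf.expectation (k s) h)"
proof -
  have "measure_pmf.expectation (p \<bind> k) h
      = (\<Sum>s\<in>set_pmf p. pmf p s *\<^sub>R measure_pmf.expectation (k s) h)"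
    by (rule pmf_expectation_bind) (use assms in auto)
  also have "\<dots> = measure_pmf.expectation p (\<lambda>s. measure_pmf.expectation (k s) h)"
    by (rule integral_measure_pmf[symmetric]) (use assms in auto)
  finally show ?thesis .
qed

definition inner_wt :: "real^'n::finite \<Rightarrow> real^'n \<Rightarrow> real^'n \<Rightarrow> real" where
  "inner_wt v x y = (\<Sum>i\<in>UNIV. v $ i * (x $ i * y $ i))"

lemma inner_wt_linear:
  "inner_wt v (x + y) w = inner_wt v x w + inner_wt v y w" "inner_wt v w (x + y) = inner_wt v w x + inner_wt v w y"
  "inner_wt v (x - y) w = inner_wt v x w - inner_wt v y w" "inner_wt v w (x - y) = inner_wt v w x - inner_wt v w y"
  "inner_wt v (c *\<^sub>R x) w = c * inner_wt v x w" "inner_wt v w (c *\<^sub>R x) = c * inner_wt v w x"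
  by (simp_all add: inner_wt_def algebra_simps sum.distrib sum_subtractf sum_distrib_left)

lemma inner_wt_commute: "inner_wt v x y = inner_wt v y x"
  by (simp add: inner_wt_def mult.commute)

lemma inner_wt_diff_square: "inner_wt v (x - y) (x - y) = inner_wt v x x + inner_wt v y y - 2 * inner_wt v x y"
  by (simp add: inner_wt_linear inner_wt_commute[of v y x])

lemma inner_wt_nonneg: "(\<And>i. v $ i > 0) \<Longrightarrow> inner_wt v x x \<ge> 0"
  unfolding inner_wt_def by (rule sum_nonneg) (simp add: mult_nonneg_nonneg[OF less_imp_le zero_le_square])

lemma norm_wt_power2: "(\<And>i. v $ i > 0) \<Longrightarrow> (norm_wt v x)\<^sup>2 = inner_wt v x x"
  using inner_wt_nonneg[of v x] by (simp add: norm_wt_def inner_wt_def power2_eq_square)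

lemma uniform_sampling_prob:
  fixes D :: "'n::finite set pmf"
  assumes "uniform_sampling D"
  shows "measure_pmf.prob D {S. i \<in> S} = tau D / real CARD('n)"
proof -
  have "tau D = measure_pmf.expectation D (\<lambda>S. \<Sum>j\<in>UNIV. indicator {S. j \<in> S} S)"
    unfolding tau_def by (simp add: indicator_def sum.If_cases)
  also have "\<dots> = (\<Sum>j\<in>UNIV. measure_pmf.prob D {S. j \<in> S})"
    by (subst Bochner_Integration.integral_sum) (auto intro: integrable_measure_pmf_finite)
  also have "\<dots> = (\<Sum>j\<in>(UNIV::'n set). measure_pmf.prob D {S. i \<in> S})"
    using assms by (intro sum.cong) (auto simp: uniform_sampling_def)
  finally show ?thesis by simp
qed

lemma uniform_sampling_expectation:
  fixes D :: "'n::finite set pmf"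
  assumes "uniform_sampling D"
  defines "t \<equiv> tau D / real CARD('n)"
  shows "measure_pmf.expectation D (\<lambda>S. \<Sum>i\<in>UNIV. if i \<in> S then a i else b i)
    = t * sum a UNIV + (1 - t) * sum b UNIV"
proof -
  have "(\<Sum>i\<in>UNIV. if i \<in> S then a i else b i)
      = (\<Sum>i\<in>UNIV. b i + (a i - b i) * indicator {S. i \<in> S} S)" for S
    by (intro sum.cong) auto
  then have "measure_pmf.expectation D (\<lambda>S. \<Sum>i\<in>UNIV. if i \<in> S then a i else b i)
      = (\<Sum>i\<in>UNIV. b i + (a i - b i) * measure_pmf.prob D {S. i \<in> S})"
    by (simp add: Bochner_Integration.integral_sum integrable_measure_pmf_finite)
  also have "\<dots> = (\<Sum>i\<in>UNIV. t * a i + (1 - t) * b i)"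
    by (simp add: uniform_sampling_prob[OF assms(1), folded t_def] algebra_simps)
  finally show ?thesis by (simp add: sum.distrib sum_distrib_left)
qed

lemma sampled_second_moment:
  fixes D :: "'n::finite set pmf"
  assumes "uniform_sampling D"
  defines "t \<equiv> tau D / real CARD('n)"
  shows "measure_pmf.expectation D
      (\<lambda>S. inner_wt v (c + l *\<^sub>R restrict_coords S h) (c + l *\<^sub>R restrict_coords S h))
    = inner_wt v c c + 2 * l * t * inner_wt v c h + l\<^sup>2 * t * inner_wt v h h"
proof -
  let ?a = "\<lambda>i. v $ i * ((c $ i + l * h $ i) * (c $ i + l * h $ i))"
  let ?b = "\<lambda>i. v $ i * (c $ i * c $ i)"
  have "inner_wt v (c + l *\<^sub>R restrict_coords S h) (c + l *\<^sub>R restrict_coords S h)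
      = (\<Sum>i\<in>UNIV. if i \<in> S then ?a i else ?b i)" for S
    unfolding inner_wt_def by (intro sum.cong) (auto simp: restrict_coords_def)
  then have "measure_pmf.expectation D
      (\<lambda>S. inner_wt v (c + l *\<^sub>R restrict_coords S h) (c + l *\<^sub>R restrict_coords S h))
    = t * sum ?a UNIV + (1 - t) * sum ?b UNIV"
    by (simp add: uniform_sampling_expectation[OF assms(1)] t_def)
  also have "sum ?a UNIV = inner_wt v (c + l *\<^sub>R h) (c + l *\<^sub>R h)" by (simp add: inner_wt_def)
  also have "sum ?b UNIV = inner_wt v c c" by (simp add: inner_wt_def)
  finally show ?thesis
    by (simp add: inner_wt_linear inner_wt_commute[of v h c] power2_eq_square algebra_simps)
qed

section \<open>One step of the method\<close>

locale approx_setting =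
  fixes f :: "real^'n::finite \<Rightarrow> real"
    and gf :: "real^'n \<Rightarrow> real^'n"
    and \<psi> :: "'n \<Rightarrow> real \<Rightarrow> ereal"
    and v :: "real^'n"
    and D :: "'n set pmf"
  assumes f_convex: "convex_on UNIV f"
    and f_grad: "\<And>x. GDERIV f x :> gf x"
    and psi_cpc: "\<And>i. closed_proper_convex (\<psi> i)"
    and v_pos: "\<And>i. v $ i > 0"
    and sampling: "uniform_sampling D"
    and tau_pos: "tau D > 0"
    and eso: "ESO f gf D v"
begin

definition t where "t = tau D / real CARD('n)"

abbreviation th :: "nat \<Rightarrow> real" where "th \<equiv> theta t"

definition Dom :: "(real^'n) set" where
  "Dom = {x. \<forall>i. x $ i \<in> eff_domain (\<psi> i)}"

definition Psi :: "real^'n \<Rightarrow> real" where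
  "Psi x = (\<Sum>i\<in>UNIV. real_of_ereal (\<psi> i (x $ i)))"

definition extrapolation :: "nat \<Rightarrow> (real^'n) \<times> (real^'n) \<Rightarrow> real^'n" where
  "extrapolation k s = (1 - th k) *\<^sub>R fst s + th k *\<^sub>R snd s"

text \<open>The step is analysed through the point reached if all coordinates were updated; the sampled
  update restricts its displacement to the chosen coordinates.\<close>

definition full_prox :: "nat \<Rightarrow> (real^'n) \<times> (real^'n) \<Rightarrow> real^'n" where
  "full_prox k s = (\<chi> i. arg_min (\<lambda>u. ereal (gf (extrapolation k s) $ i * (u - extrapolation k s $ i)
      + th k * v $ i / (2 * t) * \<bar>u - snd s $ i\<bar>\<^sup>2) + \<psi> i u) (\<lambda>_. True))"

definition displacement :: "nat \<Rightarrow> (real^'n) \<times> (real^'n) \<Rightarrow> real^'n" where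
  "displacement k s = full_prox k s - snd s"

lemma t_bounds: "0 < t" "t \<le> 1"
proof -
  show "0 < t" using tau_pos by (simp add: t_def)
  have "t = measure_pmf.prob D {S. undefined \<in> S}"
    by (simp add: t_def uniform_sampling_prob[OF sampling])
  then show "t \<le> 1" by simp
qed

lemma th_bounds: "0 < th k" "th k \<le> t" "th k \<le> 1" "th k / t \<le> 1"
  using theta_pos[OF t_bounds(1), of k] theta_le_start[OF t_bounds(1), of k] t_bounds by auto

lemma finite_set_D [simp]: "finite (set_pmf D)"
  by (rule finite_subset[of _ UNIV]) auto

lemma integrable_D [simp]: "integrable D (h :: 'n set \<Rightarrow> real)"
  by (simp add: integrable_measure_pmf_finite)

lemma approx_update_eq:
  "approx_update gf \<psi> v D k s S =
    (extrapolation k s + (th k / t) *\<^sub>R restrict_coords S (displacement k s),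
     snd s + restrict_coords S (displacement k s))"
proof -
  obtain x z where s: "s = (x, z)" by fastforce
  let ?n = "real CARD('n)"
  have coeff: "th k * ?n * w / (2 * tau D) = th k * w / (2 * t)" for w
    by (simp add: t_def)
  have step: "?n / tau D * th k = th k / t" by (simp add: t_def)
  have prox: "(\<chi> i. if i \<in> S then full_prox k s $ i else z $ i)
      = z + restrict_coords S (displacement k s)"
    by (simp add: vec_eq_iff restrict_coords_def displacement_def s)
  show ?thesis
    unfolding approx_update_def s Let_def prod.case theta_seq_def t_def[symmetric] coeff step
    using prox unfolding full_prox_def extrapolation_def s
    by (simp only: vec_lambda_beta fst_conv snd_conv add_diff_cancel_left')
qed

lemma Psi_convex: "convex_on Dom Psi"
proof (rule convex_onI)
  note conv = closed_proper_convex_real_convex[OF psi_cpc]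
  show "convex Dom"
  proof (rule convexI)
    fix x y :: "real^'n" and a b :: real
    assume *: "x \<in> Dom" "y \<in> Dom" "0 \<le> a" "0 \<le> b" "a + b = 1"
    have "a *\<^sub>R (x $ i) + b *\<^sub>R (y $ i) \<in> eff_domain (\<psi> i)" for i
      by (rule convexD[OF convex_on_imp_convex[OF conv]]) (use * in \<open>auto simp: Dom_def\<close>)
    then show "a *\<^sub>R x + b *\<^sub>R y \<in> Dom" by (simp add: Dom_def)
  qed
  fix a :: real and x y assume *: "0 < a" "a < 1" "x \<in> Dom" "y \<in> Dom"
  show "Psi ((1 - a) *\<^sub>R x + a *\<^sub>R y) \<le> (1 - a) * Psi x + a * Psi y"
    unfolding Psi_def sum_distrib_left sum.distrib[symmetric]
  proof (rule sum_mono)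
    fix i
    have "x $ i \<in> eff_domain (\<psi> i)" "y $ i \<in> eff_domain (\<psi> i)" using * by (auto simp: Dom_def)
    from convex_onD[OF conv _ _ this, of a] *
    show "real_of_ereal (\<psi> i (((1 - a) *\<^sub>R x + a *\<^sub>R y) $ i))
        \<le> (1 - a) * real_of_ereal (\<psi> i (x $ i)) + a * real_of_ereal (\<psi> i (y $ i))"
      by simp
  qed
qed

lemma Psi_convex_combination:
  assumes "x \<in> Dom" "y \<in> Dom" "0 \<le> a" "0 \<le> b" "a + b = 1"
  shows "a *\<^sub>R x + b *\<^sub>R y \<in> Dom" "Psi (a *\<^sub>R x + b *\<^sub>R y) \<le> a * Psi x + b * Psi y"
proof -
  show "a *\<^sub>R x + b *\<^sub>R y \<in> Dom"
    using convexD[OF convex_on_imp_convex[OF Psi_convex]] assms by blast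
  have a: "a = 1 - b" and "b \<le> 1" using assms by simp_all
  then show "Psi (a *\<^sub>R x + b *\<^sub>R y) \<le> a * Psi x + b * Psi y"
    unfolding a by (intro convex_onD[OF Psi_convex] assms)
qed

lemma full_prox_three_point:
  fixes k s
  defines "y \<equiv> extrapolation k s" and "p \<equiv> full_prox k s" and "h \<equiv> displacement k s"
  shows "p \<in> Dom"
    and "u \<in> Dom \<Longrightarrow> inner (gf y) (p - y) + th k / (2 * t) * inner_wt v h h + Psi p
        + th k / (2 * t) * inner_wt v (u - p) (u - p)
      \<le> inner (gf y) (u - y) + th k / (2 * t) * inner_wt v (u - snd s) (u - snd s) + Psi u"
proof -
  have c: "th k * v $ i / (2 * t) > 0" for i
    using th_bounds(1)[of k] v_pos[of i] t_bounds(1) by simp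
  have pi: "p $ i = arg_min (\<lambda>u. ereal (gf y $ i * (u - y $ i)
      + th k * v $ i / (2 * t) * \<bar>u - snd s $ i\<bar>\<^sup>2) + \<psi> i u) (\<lambda>_. True)" for i
    by (simp add: p_def full_prox_def y_def)
  show "p \<in> Dom"
    unfolding Dom_def mem_Collect_eq pi by (intro allI prox_three_point(1) psi_cpc c)
  assume u: "u \<in> Dom"
  have "(\<Sum>i\<in>UNIV. gf y $ i * (p $ i - y $ i) + th k * v $ i / (2 * t) * (p $ i - snd s $ i)\<^sup>2
        + real_of_ereal (\<psi> i (p $ i)) + th k * v $ i / (2 * t) * (u $ i - p $ i)\<^sup>2)
      \<le> (\<Sum>i\<in>UNIV. gf y $ i * (u $ i - y $ i) + th k * v $ i / (2 * t) * (u $ i - snd s $ i)\<^sup>2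
        + real_of_ereal (\<psi> i (u $ i)))"
    unfolding pi using prox_three_point(2)[OF psi_cpc c] u by (intro sum_mono) (simp add: Dom_def)
  then show "inner (gf y) (p - y) + th k / (2 * t) * inner_wt v h h + Psi p
        + th k / (2 * t) * inner_wt v (u - p) (u - p)
      \<le> inner (gf y) (u - y) + th k / (2 * t) * inner_wt v (u - snd s) (u - snd s) + Psi u"
    by (simp add: inner_vec_def inner_wt_def Psi_def sum.distrib sum_distrib_left power2_eq_square
        h_def displacement_def p_def[symmetric] mult.assoc)
qed

text \<open>Since \<open>z\<^sub>k\<close> enters $x_{k+1}$ with nonpositive weight, convexity does not bound \<open>Psi\<close> at
  $x_{k+1}$ by its values at $x_k$, $z_k$ and $z_{k+1}$. It is replaced by an upper bound for which
  such a recursion holds: the point \<open>x\<^sub>k\<close> is a convex combination of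
  \<open>z\<^sub>k\<close>, with weight \<open>last_weight k\<close>, and of a point of the domain, and the upper bound interpolates \<open>Psi\<close>
  between the two.\<close>

definition last_weight :: "nat \<Rightarrow> real" where
  "last_weight k = (case k of 0 \<Rightarrow> 1 | Suc j \<Rightarrow> th j / t)"

text \<open>For \<open>g = 1\<close>, where \<open>x\<close> and \<open>z\<close> coincide, the division by zero is masked by the factor
  \<open>1 - g\<close>.\<close>

definition split_Psi :: "real \<Rightarrow> (real^'n) \<times> (real^'n) \<Rightarrow> real" where
  "split_Psi g s = (1 - g) * Psi ((1 / (1 - g)) *\<^sub>R (fst s - g *\<^sub>R snd s)) + g * Psi (snd s)"

definition feasible :: "real \<Rightarrow> (real^'n) \<times> (real^'n) \<Rightarrow> bool" where
  "feasible g s \<longleftrightarrow> snd s \<in> Dom \<and> (\<exists>w\<in>Dom. fst s = (1 - g) *\<^sub>R w + g *\<^sub>R snd s)"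

lemma split_Psi_eq:
  assumes "x = (1 - g) *\<^sub>R w + g *\<^sub>R z"
  shows "split_Psi g (x, z) = (1 - g) * Psi w + g * Psi z"
  using assms by (cases "g = 1") (auto simp: split_Psi_def)

lemma Psi_le_split_Psi:
  assumes "feasible g s" "0 \<le> g" "g \<le> 1"
  shows "fst s \<in> Dom" "Psi (fst s) \<le> split_Psi g s"
proof -
  obtain x z where s: "s = (x, z)" by fastforce
  obtain w where w: "w \<in> Dom" "z \<in> Dom" "x = (1 - g) *\<^sub>R w + g *\<^sub>R z"
    using assms s by (auto simp: feasible_def)
  note * = Psi_convex_combination[OF w(1,2), of "1 - g" g]
  show "fst s \<in> Dom" "Psi (fst s) \<le> split_Psi g s"
    using * assms(2,3) split_Psi_eq[OF w(3)] by (simp_all add: s w(3))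
qed

text \<open>The premise \<open>q - a \<le> (1 - a) * g\<close> says that after the step the point \<open>z\<close> retains a nonnegative
  weight, so that the part of \<open>x'\<close> outside \<open>z'\<close> is again a convex combination of points of the
  domain. Then the bound obeys the same linear recursion as the iterates.\<close>

lemma split_Psi_update:
  assumes feas: "feasible g (x, z)" and z': "z' \<in> Dom"
    and par: "0 \<le> g" "g \<le> 1" "0 \<le> a" "a \<le> 1" "q \<le> 1" "q - a \<le> (1 - a) * g"
  defines "x' \<equiv> (1 - a) *\<^sub>R x + a *\<^sub>R z + q *\<^sub>R (z' - z)"
  shows "feasible q (x', z')"
    and "split_Psi q (x', z') \<le> (1 - a) * split_Psi g (x, z) - (q - a) * Psi z + q * Psi z'"
proof -
  obtain w where w: "w \<in> Dom" "z \<in> Dom" "x = (1 - g) *\<^sub>R w + g *\<^sub>R z"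
    using feas by (auto simp: feasible_def)
  define b where "b = (1 - a) * (1 - g)"
  define c where "c = (1 - a) * g - (q - a)"
  have bc: "0 \<le> b" "0 \<le> c" "b + c = 1 - q" 
    using par mult_nonneg_nonneg[of "1 - a" "1 - g"] unfolding b_def c_def
    by (simp, simp, simp add: algebra_simps)
  have x': "x' = (b *\<^sub>R w + c *\<^sub>R z) + q *\<^sub>R z'"
    by (simp add: x'_def w(3) b_def c_def algebra_simps)
  obtain w' where w': "w' \<in> Dom" "b *\<^sub>R w + c *\<^sub>R z = (1 - q) *\<^sub>R w'"
    "(1 - q) * Psi w' \<le> b * Psi w + c * Psi z"
  proof (cases "q = 1")
    case True
    then have "b = 0" "c = 0" using bc by auto
    then show ?thesis using that[of z] w True by simp
  next
    case False
    then have q: "1 - q > 0" using par by simp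
    let ?w = "(b / (1 - q)) *\<^sub>R w + (c / (1 - q)) *\<^sub>R z"
    have sum1: "b / (1 - q) + c / (1 - q) = 1" using bc q by (simp add: add_divide_distrib[symmetric])
    note * = Psi_convex_combination[OF w(1,2) _ _ sum1]
    show ?thesis
    proof (rule that[of ?w])
      show "?w \<in> Dom" using * bc q by simp
      show "b *\<^sub>R w + c *\<^sub>R z = (1 - q) *\<^sub>R ?w" using q by (simp add: scaleR_add_right)
      have "(1 - q) * Psi ?w \<le> (1 - q) * (b / (1 - q) * Psi w + c / (1 - q) * Psi z)"
        using * bc q by (intro mult_left_mono) auto
      also have "\<dots> = b * Psi w + c * Psi z" using q by (simp add: distrib_left)
      finally show "(1 - q) * Psi ?w \<le> b * Psi w + c * Psi z" .
    qed
  qed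
  have x'': "x' = (1 - q) *\<^sub>R w' + q *\<^sub>R z'" using x' w'(2) by simp
  then show "feasible q (x', z')" using w'(1) z' by (auto simp: feasible_def)
  show "split_Psi q (x', z') \<le> (1 - a) * split_Psi g (x, z) - (q - a) * Psi z + q * Psi z'"
    unfolding split_Psi_eq[OF x''] split_Psi_eq[OF w(3)]
    using w'(3) by (simp add: b_def c_def algebra_simps)
qed

definition upper_cost :: "nat \<Rightarrow> (real^'n) \<times> (real^'n) \<Rightarrow> real" where
  "upper_cost k s = f (fst s) + split_Psi (last_weight k) s"

lemma last_weight_bounds: "0 \<le> last_weight k" "last_weight k \<le> 1"
  using th_bounds t_bounds(1) by (auto simp: last_weight_def less_imp_le split: nat.split)

lemma last_weight_step: "th k / t - th k \<le> (1 - th k) * last_weight k"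
  using theta_weight_nonneg[OF t_bounds] t_bounds(1) by (auto simp: last_weight_def split: nat.split)

lemma partial_prox_Dom:
  assumes "snd s \<in> Dom"
  shows "snd s + restrict_coords S (displacement k s) \<in> Dom"
  using assms full_prox_three_point(1)[of k s]
  by (auto simp: Dom_def restrict_coords_def displacement_def)

lemma expectation_Psi_partial_prox:
  "measure_pmf.expectation D (\<lambda>S. Psi (snd s + restrict_coords S (displacement k s)))
    = t * Psi (full_prox k s) + (1 - t) * Psi (snd s)"
proof -
  have "Psi (snd s + restrict_coords S (displacement k s)) = (\<Sum>i\<in>UNIV. if i \<in> S
      then real_of_ereal (\<psi> i (full_prox k s $ i)) else real_of_ereal (\<psi> i (snd s $ i)))" for S
    unfolding Psi_def by (intro sum.cong) (auto simp: restrict_coords_def displacement_def)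
  then show ?thesis
    by (simp add: uniform_sampling_expectation[OF sampling] t_def Psi_def)
qed

lemma feasible_update:
  assumes "feasible (last_weight k) s"
  shows "feasible (last_weight (Suc k)) (approx_update gf \<psi> v D k s S)"
    and "split_Psi (last_weight (Suc k)) (approx_update gf \<psi> v D k s S)
      \<le> (1 - th k) * split_Psi (last_weight k) s - (th k / t - th k) * Psi (snd s)
        + th k / t * Psi (snd s + restrict_coords S (displacement k s))"
proof -
  obtain x z where s: "s = (x, z)" by fastforce
  let ?z' = "z + restrict_coords S (displacement k s)"
  have z': "?z' \<in> Dom" using partial_prox_Dom[of s S k] assms by (simp add: feasible_def s)
  have upd: "approx_update gf \<psi> v D k s S
      = ((1 - th k) *\<^sub>R x + th k *\<^sub>R z + (th k / t) *\<^sub>R (?z' - z), ?z')"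
    by (simp add: approx_update_eq extrapolation_def s)
  note * = split_Psi_update[OF assms[unfolded s] z', of "th k" "th k / t"]
  show "feasible (last_weight (Suc k)) (approx_update gf \<psi> v D k s S)"
    "split_Psi (last_weight (Suc k)) (approx_update gf \<psi> v D k s S)
      \<le> (1 - th k) * split_Psi (last_weight k) s - (th k / t - th k) * Psi (snd s)
        + th k / t * Psi (snd s + restrict_coords S (displacement k s))"
    unfolding upd using * last_weight_bounds[of k] th_bounds[of k] last_weight_step[of k]
    by (simp_all add: last_weight_def s less_imp_le)
qed

text \<open>The expected separable overapproximation bounds the smooth part, and the upper bound on the
  nonsmooth part is affine in \<open>Psi\<close> of the sampled second iterate. Both expectations are thus
  expressed by the full step, whose optimality is the three-point inequality. The comparison point
  \<open>u\<close> is left free because two choices are needed: the minimizer and the current iterate.\<close>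

lemma expected_cost_step:
  fixes s :: "(real^'n) \<times> (real^'n)" and k :: nat
  defines "h \<equiv> displacement k s"
  assumes feas: "feasible (last_weight k) s" and u: "u \<in> Dom"
  shows "measure_pmf.expectation D (\<lambda>S. upper_cost (Suc k) (approx_update gf \<psi> v D k s S))
    \<le> (1 - th k) * upper_cost k s + th k * (f u + Psi u)
      - (th k)\<^sup>2 / (2 * t) * (2 * inner_wt v (snd s - u) h + inner_wt v h h)"
proof -
  obtain x z where s: "s = (x, z)" by fastforce
  let ?E = "measure_pmf.expectation D"
  let ?y = "extrapolation k s" and ?p = "full_prox k s" and ?q = "th k / t"
  let ?g = "gf ?y" and ?a = "th k"
  have a: "0 < ?a" "?a \<le> 1" using th_bounds by auto
  have qt: "?q * t = ?a" using t_bounds by simp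
  have smooth: "?E (\<lambda>S. f (?y + ?q *\<^sub>R restrict_coords S h))
      \<le> f ?y + ?a * inner ?g h + ?a\<^sup>2 / (2 * t) * inner_wt v h h"
  proof -
    have scale: "restrict_coords S (?q *\<^sub>R h) = ?q *\<^sub>R restrict_coords S h" for S
      by (simp add: restrict_coords_def vec_eq_iff)
    have "?E (\<lambda>S. f (?y + restrict_coords S (?q *\<^sub>R h)))
        \<le> f ?y + t * (inner ?g (?q *\<^sub>R h) + 1 / 2 * (norm_wt v (?q *\<^sub>R h))\<^sup>2)"
      using eso unfolding ESO_def t_def by blast
    then have "?E (\<lambda>S. f (?y + ?q *\<^sub>R restrict_coords S h))
        \<le> f ?y + t * (inner ?g (?q *\<^sub>R h) + 1 / 2 * (norm_wt v (?q *\<^sub>R h))\<^sup>2)"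
      unfolding scale .
    also have "\<dots> = f ?y + ?q * t * inner ?g h + (?q * t)\<^sup>2 / (2 * t) * inner_wt v h h"
      unfolding norm_wt_power2[OF v_pos] inner_wt_linear
      using t_bounds(1) by (simp add: power2_eq_square field_simps)
    finally show ?thesis unfolding qt .
  qed
  have nonsmooth: "?E (\<lambda>S. split_Psi (last_weight (Suc k)) (approx_update gf \<psi> v D k s S))
      \<le> (1 - ?a) * split_Psi (last_weight k) s + ?a * Psi ?p"
  proof -
    have "?E (\<lambda>S. split_Psi (last_weight (Suc k)) (approx_update gf \<psi> v D k s S))
      \<le> ?E (\<lambda>S. (1 - ?a) * split_Psi (last_weight k) s - (?q - ?a) * Psi z
          + ?q * Psi (snd s + restrict_coords S (displacement k s)))"
      using feasible_update(2)[OF feas] by (intro expectation_finite_mono) (auto simp: s)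
    also have "\<dots> = (1 - ?a) * split_Psi (last_weight k) s - (?q - ?a) * Psi z
        + ?q * (t * Psi ?p + (1 - t) * Psi z)"
      using expectation_Psi_partial_prox[of s k] by (simp add: s)
    also have "\<dots> = (1 - ?a) * split_Psi (last_weight k) s + (?q * t) * Psi ?p
        + (?a - ?q * t) * Psi z"
      by (simp add: algebra_simps)
    finally show ?thesis unfolding qt by simp
  qed
  have pz: "?p = z + h" by (simp add: h_def displacement_def s)
  have prox: "?a * Psi ?p + ?a\<^sup>2 / (2 * t) * inner_wt v h h
      \<le> ?a * inner ?g (u - ?p) + ?a * Psi u
        - ?a\<^sup>2 / (2 * t) * (2 * inner_wt v (z - u) h + inner_wt v h h)"
  proof -
    have "inner ?g (?p - ?y) + ?a / (2 * t) * inner_wt v h h + Psi ?p + ?a / (2 * t) * inner_wt v (u - ?p) (u - ?p)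
      \<le> inner ?g (u - ?y) + ?a / (2 * t) * inner_wt v (u - z) (u - z) + Psi u"
      using full_prox_three_point(2)[OF u, of k s] by (simp add: h_def s)
    moreover have "?a / (2 * t) * inner_wt v (u - ?p) (u - ?p)
        = ?a / (2 * t) * inner_wt v (u - z) (u - z) + ?a / (2 * t) * (2 * inner_wt v (z - u) h + inner_wt v h h)"
      unfolding distrib_left[symmetric]
      by (simp add: pz inner_wt_linear inner_wt_commute algebra_simps)
    moreover have "inner ?g (u - ?y) - inner ?g (?p - ?y) = inner ?g (u - ?p)"
      by (simp add: inner_diff_right)
    ultimately have "Psi ?p + ?a / (2 * t) * inner_wt v h h
        \<le> inner ?g (u - ?p) + Psi u - ?a / (2 * t) * (2 * inner_wt v (z - u) h + inner_wt v h h)"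
      by linarith
    then have "?a * (Psi ?p + ?a / (2 * t) * inner_wt v h h)
        \<le> ?a * (inner ?g (u - ?p) + Psi u - ?a / (2 * t) * (2 * inner_wt v (z - u) h + inner_wt v h h))"
      using a by (intro mult_left_mono) auto
    moreover have "?a\<^sup>2 / (2 * t) = ?a * (?a / (2 * t))" by (simp add: power2_eq_square)
    ultimately show ?thesis by (simp only: distrib_left right_diff_distrib mult.assoc)
  qed
  have grad: "f ?y + ?a * inner ?g h + ?a * inner ?g (u - ?p) \<le> (1 - ?a) * f x + ?a * f u"
  proof -
    have "?a *\<^sub>R (u - z) = ?a *\<^sub>R (u - ?y) + (1 - ?a) *\<^sub>R (x - ?y)"
      by (simp add: extrapolation_def s algebra_simps)
    then have "?a * inner ?g (u - z) = ?a * inner ?g (u - ?y) + (1 - ?a) * inner ?g (x - ?y)"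
      by (metis inner_add_right inner_scaleR_right)
    moreover have "?a * inner ?g h + ?a * inner ?g (u - ?p) = ?a * inner ?g (u - z)"
      by (simp add: pz inner_diff_right inner_add_right algebra_simps)
    moreover have "?a * (f ?y + inner ?g (u - ?y)) \<le> ?a * f u"
      "(1 - ?a) * (f ?y + inner ?g (x - ?y)) \<le> (1 - ?a) * f x"
      using a by (auto intro!: mult_left_mono convex_gradient_inequality f_convex f_grad)
    ultimately show ?thesis by (simp add: algebra_simps)
  qed
  have "?E (\<lambda>S. upper_cost (Suc k) (approx_update gf \<psi> v D k s S))
      = ?E (\<lambda>S. f (?y + ?q *\<^sub>R restrict_coords S h))
        + ?E (\<lambda>S. split_Psi (last_weight (Suc k)) (approx_update gf \<psi> v D k s S))"
    unfolding upper_cost_def by (simp add: approx_update_eq h_def)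
  also have "\<dots> \<le> (f ?y + ?a * inner ?g h + ?a\<^sup>2 / (2 * t) * inner_wt v h h)
      + ((1 - ?a) * split_Psi (last_weight k) s + ?a * Psi ?p)"
    using smooth nonsmooth by (rule add_mono)
  also have "\<dots> \<le> (1 - ?a) * f x + ?a * f u + (1 - ?a) * split_Psi (last_weight k) s + ?a * Psi u
      - ?a\<^sup>2 / (2 * t) * (2 * inner_wt v (z - u) h + inner_wt v h h)"
    using prox grad by linarith
  also have "\<dots> = (1 - ?a) * upper_cost k s + ?a * (f u + Psi u)
      - ?a\<^sup>2 / (2 * t) * (2 * inner_wt v (snd s - u) h + inner_wt v h h)"
    by (simp add: upper_cost_def s algebra_simps)
  finally show ?thesis .
qed

section \<open>One run of the method\<close>

abbreviation states :: "real^'n \<Rightarrow> nat \<Rightarrow> ((real^'n) \<times> (real^'n)) pmf" where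
  "states \<equiv> approx_state gf \<psi> v D"

abbreviation Fval :: "real^'n \<Rightarrow> real" where
  "Fval x \<equiv> f x + Psi x"

lemma finite_states [simp]: "finite (set_pmf (states x0 k))"
  by (induction k) auto

lemma integrable_states [simp]: "integrable (states x0 k) (h :: _ \<Rightarrow> real)"
  by (simp add: integrable_measure_pmf_finite)

lemma states_feasible:
  assumes "x0 \<in> Dom" "s \<in> set_pmf (states x0 k)"
  shows "feasible (last_weight k) s"
  using assms(2)
proof (induction k arbitrary: s)
  case 0
  then show ?case using assms(1) by (auto simp: feasible_def last_weight_def)
next
  case (Suc k)
  then show ?case by (auto intro: feasible_update(1))
qed

lemma expectation_states_Suc:
  fixes h :: "(real^'n) \<times> (real^'n) \<Rightarrow> real"
  shows "measure_pmf.expectation (states x0 (Suc k)) h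
    = measure_pmf.expectation (states x0 k)
        (\<lambda>s. measure_pmf.expectation D (\<lambda>S. h (approx_update gf \<psi> v D k s S)))"
  by (simp add: expectation_bind_finite)

text \<open>A run starts with equal iterates, and the first step moves both by the sampled displacement
  because $\theta_0/t = 1$.\<close>

lemma states_1_diagonal:
  assumes "s \<in> set_pmf (states x0 (Suc 0))"
  shows "fst s = snd s"
proof -
  have "th 0 / t = 1" using t_bounds(1) by simp
  then show ?thesis
    using assms by (auto simp: approx_update_eq extrapolation_def algebra_simps)
qed

text \<open>Each of the three differences is a fixed vector plus a multiple of the sampled displacement, so
  its second moment follows from \<open>sampled_second_moment\<close>.\<close>

lemma expected_second_moments:
  fixes s :: "(real^'n) \<times> (real^'n)" and xs :: "real^'n" and k :: nat
  defines "h \<equiv> displacement k s" and "q \<equiv> th k / t"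
    and "upd \<equiv> approx_update gf \<psi> v D k s"
    and "d \<equiv> inner_wt v (fst s - xs) (fst s - xs)" and "e \<equiv> inner_wt v (snd s - xs) (snd s - xs)"
    and "U \<equiv> inner_wt v (fst s - snd s) (fst s - snd s)"
  shows "measure_pmf.expectation D (\<lambda>S. inner_wt v (snd (upd S) - xs) (snd (upd S) - xs))
      = e + 2 * t * inner_wt v (snd s - xs) h + t * inner_wt v h h"
    and "measure_pmf.expectation D (\<lambda>S. inner_wt v (fst (upd S) - xs) (fst (upd S) - xs))
      = (1 - th k) * d + th k * e - th k * (1 - th k) * U
        + 2 * th k * ((1 - th k) * inner_wt v (fst s - snd s) h + inner_wt v (snd s - xs) h)
        + th k * q * inner_wt v h h"
    and "measure_pmf.expectation D (\<lambda>S. inner_wt v (fst (upd S) - snd (upd S)) (fst (upd S) - snd (upd S)))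
      = (1 - th k)\<^sup>2 * U - 2 * t * (1 - th k) * (1 - q) * inner_wt v (fst s - snd s) h
        + t * (1 - q)\<^sup>2 * inner_wt v h h"
proof -
  note moment = sampled_second_moment[OF sampling, folded t_def, of v _ _ h]
  have qt: "q * t = th k" using t_bounds(1) by (simp add: q_def)
  have *: "snd (upd S) - xs = (snd s - xs) + 1 *\<^sub>R restrict_coords S h" for S
    by (simp add: upd_def approx_update_eq h_def)
  show "measure_pmf.expectation D (\<lambda>S. inner_wt v (snd (upd S) - xs) (snd (upd S) - xs))
      = e + 2 * t * inner_wt v (snd s - xs) h + t * inner_wt v h h"
    unfolding * moment by (simp add: e_def)
  have *: "fst (upd S) - xs = ((1 - th k) *\<^sub>R (fst s - xs) + th k *\<^sub>R (snd s - xs))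
      + q *\<^sub>R restrict_coords S h" for S
    by (simp add: upd_def approx_update_eq h_def extrapolation_def q_def algebra_simps)
  have cross: "inner_wt v ((1 - th k) *\<^sub>R (fst s - xs) + th k *\<^sub>R (snd s - xs)) h
      = (1 - th k) * inner_wt v (fst s - snd s) h + inner_wt v (snd s - xs) h"
    by (simp add: inner_wt_linear algebra_simps)
  have square: "inner_wt v ((1 - th k) *\<^sub>R (fst s - xs) + th k *\<^sub>R (snd s - xs))
        ((1 - th k) *\<^sub>R (fst s - xs) + th k *\<^sub>R (snd s - xs))
      = (1 - th k) * d + th k * e - th k * (1 - th k) * U"
  proof -
    have U: "U = d + e - 2 * inner_wt v (fst s - xs) (snd s - xs)"
      using inner_wt_diff_square[of v "fst s - xs" "snd s - xs"] by (simp add: U_def d_def e_def)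
    show ?thesis
      unfolding U inner_wt_linear(1,2,5,6) inner_wt_commute[of v "snd s - xs" "fst s - xs"]
        d_def[symmetric] e_def[symmetric]
      by (simp add: algebra_simps)
  qed
  have "measure_pmf.expectation D (\<lambda>S. inner_wt v (fst (upd S) - xs) (fst (upd S) - xs))
      = ((1 - th k) * d + th k * e - th k * (1 - th k) * U)
        + 2 * (q * t) * ((1 - th k) * inner_wt v (fst s - snd s) h + inner_wt v (snd s - xs) h)
        + (q * t) * q * inner_wt v h h"
    unfolding * moment cross square by (simp add: power2_eq_square)
  then show "measure_pmf.expectation D (\<lambda>S. inner_wt v (fst (upd S) - xs) (fst (upd S) - xs))
      = (1 - th k) * d + th k * e - th k * (1 - th k) * U
        + 2 * th k * ((1 - th k) * inner_wt v (fst s - snd s) h + inner_wt v (snd s - xs) h)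
        + th k * q * inner_wt v h h"
    unfolding qt .
  have *: "fst (upd S) - snd (upd S) = (1 - th k) *\<^sub>R (fst s - snd s)
      + (q - 1) *\<^sub>R restrict_coords S h" for S
    by (simp add: upd_def approx_update_eq h_def extrapolation_def q_def algebra_simps)
  show "measure_pmf.expectation D (\<lambda>S. inner_wt v (fst (upd S) - snd (upd S)) (fst (upd S) - snd (upd S)))
      = (1 - th k)\<^sup>2 * U - 2 * t * (1 - th k) * (1 - q) * inner_wt v (fst s - snd s) h
        + t * (1 - q)\<^sup>2 * inner_wt v h h"
    unfolding * moment by (simp add: inner_wt_linear U_def power2_eq_square algebra_simps)
qed

text \<open>The joint bound on gap and distance after one run: \<open>accelerated_sequence_bound\<close> applied to the
  expectations. Comparison with \<open>xs\<close> yields the hypothesis \<open>optimal\<close> and comparison with the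
  current first iterate yields \<open>energy\<close>.\<close>

lemma approx_distance_gap_bound:
  fixes x0 xs :: "real^'n"
  assumes x0: "x0 \<in> Dom" and xs: "xs \<in> Dom" and min: "\<And>u. u \<in> Dom \<Longrightarrow> Fval xs \<le> Fval u"
  shows "measure_pmf.expectation (states x0 (Suc k)) (\<lambda>s. inner_wt v (fst s - xs) (fst s - xs))
      + t\<^sup>2 / (th k)\<^sup>2 * measure_pmf.expectation (states x0 (Suc k)) (\<lambda>s. Fval (fst s) - Fval xs)
    \<le> 2 * (1 - t) * (Fval x0 - Fval xs) + inner_wt v (x0 - xs) (x0 - xs)"
proof -
  let ?E = "\<lambda>k. measure_pmf.expectation (states x0 k)"
  let ?ED = "measure_pmf.expectation D"
  \<comment> \<open>the factor makes the gap comparable with squared distances without further constants\<close>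
  define a where "a k = 2 * t\<^sup>2 * ?E k (\<lambda>s. upper_cost k s - Fval xs)" for k
  define d where "d k = ?E k (\<lambda>s. inner_wt v (fst s - xs) (fst s - xs))" for k
  define e where "e k = ?E k (\<lambda>s. inner_wt v (snd s - xs) (snd s - xs))" for k
  define U where "U k = ?E k (\<lambda>s. inner_wt v (fst s - snd s) (fst s - snd s))" for k
  define M where "M k = ?E k (\<lambda>s. inner_wt v (fst s - snd s) (displacement k s))" for k
  define N where "N k = ?E k (\<lambda>s. inner_wt v (displacement k s) (displacement k s))" for k
  define Z where "Z k = ?E k (\<lambda>s. inner_wt v (snd s - xs) (displacement k s))" for k
  have gap: "Fval (fst s) \<le> upper_cost k s" "fst s \<in> Dom" if "s \<in> set_pmf (states x0 k)" for s k
    using Psi_le_split_Psi[OF states_feasible[OF x0 that] last_weight_bounds] by (auto simp: upper_cost_def)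
  have cost_step: "a (Suc k) \<le> 2 * t\<^sup>2 * ?E k (\<lambda>s. (1 - th k) * upper_cost k s + th k * Fval (u s)
      - (th k)\<^sup>2 / (2 * t) * (2 * inner_wt v (snd s - u s) (displacement k s)
          + inner_wt v (displacement k s) (displacement k s)) - Fval xs)"
    if u: "\<And>s. s \<in> set_pmf (states x0 k) \<Longrightarrow> u s \<in> Dom" for u k
    unfolding a_def expectation_states_Suc
  proof (intro mult_left_mono expectation_finite_mono)
    fix s assume s: "s \<in> set_pmf (states x0 k)"
    show "?ED (\<lambda>S. upper_cost (Suc k) (approx_update gf \<psi> v D k s S) - Fval xs)
      \<le> (1 - th k) * upper_cost k s + th k * Fval (u s)
      - (th k)\<^sup>2 / (2 * t) * (2 * inner_wt v (snd s - u s) (displacement k s)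
          + inner_wt v (displacement k s) (displacement k s)) - Fval xs"
      using expected_cost_step[OF states_feasible[OF x0 s] u[OF s]] by simp
  qed auto
  have e_step: "e (Suc k) = e k + 2 * t * Z k + t * N k" for k
    unfolding e_def expectation_states_Suc expected_second_moments(1)
    by (simp add: Z_def N_def)
  have bound: "d (Suc k) + a (Suc k) / (2 * (th k)\<^sup>2) \<le> (1 - t) / t\<^sup>2 * a 0 + e 0"
  proof (rule accelerated_sequence_bound[OF t_bounds, where U = U and M = M and N = N])
    fix k
    have "0 \<le> ?E k (\<lambda>s. upper_cost k s - Fval xs)"
    proof (rule integral_nonneg_AE, unfold AE_measure_pmf_iff, rule ballI)
      fix s assume "s \<in> set_pmf (states x0 k)"
      then show "0 \<le> upper_cost k s - Fval xs" using gap[of s k] min[of "fst s"] by simp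
    qed
    then show "0 \<le> a k" by (simp add: a_def)
    show "0 \<le> U k"
      unfolding U_def by (intro Bochner_Integration.integral_nonneg inner_wt_nonneg v_pos)
    show "0 \<le> N k"
      unfolding N_def by (intro Bochner_Integration.integral_nonneg inner_wt_nonneg v_pos)
    have "a (Suc k) \<le> 2 * t\<^sup>2 * ?E k (\<lambda>s. (1 - th k) * upper_cost k s + th k * Fval xs
      - (th k)\<^sup>2 / (2 * t) * (2 * inner_wt v (snd s - xs) (displacement k s)
          + inner_wt v (displacement k s) (displacement k s)) - Fval xs)"
      by (rule cost_step) (rule xs)
    also have "\<dots> = (1 - th k) * a k - (th k)\<^sup>2 * (2 * t * Z k + t * N k)"
      using t_bounds(1) by (simp add: a_def Z_def N_def power2_eq_square field_simps)
    finally show "a (Suc k) + (th k)\<^sup>2 * e (Suc k) \<le> (1 - th k) * a k + (th k)\<^sup>2 * e k"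
      by (simp add: e_step algebra_simps)
    have "a (Suc k) \<le> 2 * t\<^sup>2 * ?E k (\<lambda>s. (1 - th k) * upper_cost k s + th k * Fval (fst s)
      - (th k)\<^sup>2 / (2 * t) * (2 * inner_wt v (snd s - fst s) (displacement k s)
          + inner_wt v (displacement k s) (displacement k s)) - Fval xs)"
      by (rule cost_step) (rule gap(2))
    also have "\<dots> \<le> 2 * t\<^sup>2 * ?E k (\<lambda>s. (upper_cost k s - Fval xs)
      + (th k)\<^sup>2 / (2 * t) * (2 * inner_wt v (fst s - snd s) (displacement k s)
          - inner_wt v (displacement k s) (displacement k s)))"
    proof (intro mult_left_mono expectation_finite_mono)
      fix s assume s: "s \<in> set_pmf (states x0 k)"
      have "th k * Fval (fst s) \<le> th k * upper_cost k s"
        using gap(1)[OF s] th_bounds(1)[of k] by (intro mult_left_mono) auto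
      moreover have "inner_wt v (snd s - fst s) (displacement k s) = - inner_wt v (fst s - snd s) (displacement k s)"
        by (simp add: inner_wt_linear)
      ultimately show "(1 - th k) * upper_cost k s + th k * Fval (fst s)
        - (th k)\<^sup>2 / (2 * t) * (2 * inner_wt v (snd s - fst s) (displacement k s)
          + inner_wt v (displacement k s) (displacement k s)) - Fval xs
        \<le> (upper_cost k s - Fval xs) + (th k)\<^sup>2 / (2 * t) * (2 * inner_wt v (fst s - snd s) (displacement k s)
          - inner_wt v (displacement k s) (displacement k s))"
        by (simp add: algebra_simps)
    qed auto
    also have "\<dots> = a k + (th k)\<^sup>2 * t * (2 * M k - N k)"
      using t_bounds(1) by (simp add: a_def M_def N_def power2_eq_square field_simps)
    finally show "a (Suc k) \<le> a k + (th k)\<^sup>2 * t * (2 * M k - N k)" .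
    have "d (Suc k) = (1 - th k) * d k + th k * e k - th k * (1 - th k) * U k
        + 2 * th k * ((1 - th k) * M k + Z k) + th k * (th k / t) * N k"
      unfolding d_def expectation_states_Suc expected_second_moments(2)
      by (simp add: d_def e_def U_def M_def N_def Z_def)
    also have "\<dots> = (1 - th k) * d k - (th k / t - th k) * e k
        + th k / t * (e k + 2 * t * Z k + t * N k)
        - th k * ((1 - th k) * (U k - 2 * M k + N k) - (th k / t - th k) * N k)"
      using t_bounds(1) by (simp add: field_simps)
    finally show "d (Suc k) = (1 - th k) * d k - (th k / t - th k) * e k + th k / t * e (Suc k)
        - th k * ((1 - th k) * (U k - 2 * M k + N k) - (th k / t - th k) * N k)"
      unfolding e_step .
    show "U (Suc k) = (1 - th k)\<^sup>2 * U k - 2 * t * (1 - th k) * (1 - th k / t) * M k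
        + t * (1 - th k / t)\<^sup>2 * N k"
      unfolding U_def expectation_states_Suc expected_second_moments(3)
      by (simp add: U_def M_def N_def)
  next
    show "d 1 = e 1"
      unfolding d_def e_def One_nat_def
      by (intro integral_cong_AE) (auto simp: AE_measure_pmf_iff simp del: approx_state.simps
          dest: states_1_diagonal)
    have "U 1 = ?E 1 (\<lambda>s. 0)"
      unfolding U_def One_nat_def
      by (intro integral_cong_AE) (auto simp: AE_measure_pmf_iff inner_wt_def simp del: approx_state.simps
          dest: states_1_diagonal)
    then show "U 1 = 0" by simp
  qed simp
  have "upper_cost 0 (x0, x0) = Fval x0" by (simp add: upper_cost_def last_weight_def split_Psi_def)
  then have "a 0 = 2 * t\<^sup>2 * (Fval x0 - Fval xs)" unfolding a_def by simp
  moreover have "(1 - t) / t\<^sup>2 * (2 * t\<^sup>2 * X) = 2 * (1 - t) * X" for X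
    using t_bounds(1) by (simp add: field_simps)
  ultimately have a0: "(1 - t) / t\<^sup>2 * a 0 = 2 * (1 - t) * (Fval x0 - Fval xs)"
    by (simp only:)
  have e0: "e 0 = inner_wt v (x0 - xs) (x0 - xs)" by (simp add: e_def)
  have "?E (Suc k) (\<lambda>s. Fval (fst s) - Fval xs) \<le> ?E (Suc k) (\<lambda>s. upper_cost (Suc k) s - Fval xs)"
    using gap(1)[of _ "Suc k"] by (intro expectation_finite_mono finite_states) simp
  then have "t\<^sup>2 / (th k)\<^sup>2 * ?E (Suc k) (\<lambda>s. Fval (fst s) - Fval xs)
      \<le> t\<^sup>2 / (th k)\<^sup>2 * ?E (Suc k) (\<lambda>s. upper_cost (Suc k) s - Fval xs)"
    by (intro mult_left_mono) simp_all
  also have "\<dots> = a (Suc k) / (2 * (th k)\<^sup>2)" by (simp add: a_def)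
  finally show ?thesis using bound[unfolded a0 e0] unfolding d_def by linarith
qed

section \<open>Contraction under quadratic growth and restarts\<close>

definition potential :: "real^'n \<Rightarrow> real^'n \<Rightarrow> real" where
  "potential xs x = (1 - t) / t\<^sup>2 * (Fval x - Fval xs) + 1 / (2 * t\<^sup>2) * inner_wt v (x - xs) (x - xs)"

text \<open>This is where the length of a run matters: by \<open>inverse_theta_growth\<close>, after $K \ge 1/t$ steps
  $t/\theta_{K-1} \ge (3-t)/2$, and $(3-t)^2/4 - 2(1-t) = (1+t)^2/4$.\<close>

lemma theta_ratio_large:
  assumes "real K \<ge> 1 / t"
  shows "2 * (1 - t) \<le> t\<^sup>2 / (th (K - 1))\<^sup>2"
proof -
  have "0 < 1 / t" using t_bounds(1) by simp
  then obtain j where K: "K = Suc j" using assms by (cases K) auto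
  have "1 / t + (1 / t - 1) / 2 \<le> 1 / t + real j / 2"
    using assms by (simp add: K)
  also have "\<dots> \<le> 1 / th j"
    by (rule inverse_theta_growth[OF t_bounds(1)])
  finally have "1 / t + (1 / t - 1) / 2 \<le> 1 / th j" .
  then have "1 / th (K - 1) \<ge> 1 / t + (1 / t - 1) / 2" by (simp add: K)
  then have "t * (1 / th (K - 1)) \<ge> t * (1 / t + (1 / t - 1) / 2)"
    using t_bounds(1) by (intro mult_left_mono) auto
  also have "t * (1 / t + (1 / t - 1) / 2) = (3 - t) / 2"
    using t_bounds(1) by (simp add: field_simps)
  finally have "((3 - t) / 2)\<^sup>2 \<le> (t * (1 / th (K - 1)))\<^sup>2"
    using t_bounds by (intro power_mono) auto
  moreover have "2 * (1 - t) \<le> ((3 - t) / 2)\<^sup>2"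
    using zero_le_power2[of "t + 1"] by (simp add: power2_eq_square field_simps)
  moreover have "(t * (1 / th (K - 1)))\<^sup>2 = t\<^sup>2 / (th (K - 1))\<^sup>2"
    by (simp add: power_divide)
  ultimately show ?thesis by linarith
qed

text \<open>With \<open>G\<close> the expected gap, \<open>d\<close> the expected squared distance and $B = t^2/\theta_{K-1}^2$,
  the potential is $((1-t)G + d/2)/t^2$. It is bounded by combining $d + BG \le R$ and
  $\mu d/2 \le G$ with the multipliers that match the coefficients of both \<open>d\<close> and \<open>G\<close>; the second
  multiplier is nonnegative because $B/2 \ge 1 - t$.\<close>

lemma approx_contraction:
  fixes x0 xs :: "real^'n"
  assumes x0: "x0 \<in> Dom" and xs: "xs \<in> Dom" and min: "\<And>u. u \<in> Dom \<Longrightarrow> Fval xs \<le> Fval u"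
    and mu: "\<mu> > 0"
    and growth: "\<And>u. u \<in> Dom \<Longrightarrow> Fval xs + \<mu> / 2 * inner_wt v (u - xs) (u - xs) \<le> Fval u"
    and K: "real K \<ge> 1 / t"
  shows "measure_pmf.expectation (approx gf \<psi> v D x0 K) (potential xs)
    \<le> (1 + (1 - t) * \<mu>) / (1 + t\<^sup>2 / (2 * (th (K - 1))\<^sup>2) * \<mu>) * potential xs x0"
proof -
  let ?E = "measure_pmf.expectation (states x0 K)"
  define B where "B = t\<^sup>2 / (th (K - 1))\<^sup>2"
  define G where "G = ?E (\<lambda>s. Fval (fst s) - Fval xs)"
  define d where "d = ?E (\<lambda>s. inner_wt v (fst s - xs) (fst s - xs))"
  define R where "R = 2 * (1 - t) * (Fval x0 - Fval xs) + inner_wt v (x0 - xs) (x0 - xs)"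
  have "0 < 1 / t" using t_bounds(1) by simp
  then have "K \<noteq> 0" using K by (intro notI) simp
  then have "Suc (K - 1) = K" by simp
  then have bound: "d + B * G \<le> R"
    using approx_distance_gap_bound[OF x0 xs min, of "K - 1"] by (simp add: B_def G_def d_def R_def)
  have dG: "\<mu> / 2 * d \<le> G"
  proof -
    have "?E (\<lambda>s. \<mu> / 2 * inner_wt v (fst s - xs) (fst s - xs)) \<le> G"
      unfolding G_def
    proof (rule expectation_finite_mono)
      fix s assume "s \<in> set_pmf (states x0 K)"
      then have "fst s \<in> Dom"
        using Psi_le_split_Psi(1)[OF states_feasible[OF x0] last_weight_bounds] by blast
      then show "\<mu> / 2 * inner_wt v (fst s - xs) (fst s - xs) \<le> Fval (fst s) - Fval xs"
        using growth[of "fst s"] by simp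
    qed simp
    then show ?thesis by (simp add: d_def)
  qed
  have B: "2 * (1 - t) \<le> B" "0 < 1 + B / 2 * \<mu>"
    using theta_ratio_large[OF K] t_bounds mu by (auto simp: B_def add_pos_nonneg)
  have "((1 - t) * G + d / 2) * (1 + B / 2 * \<mu>)
      = (1 + (1 - t) * \<mu>) * ((d + B * G) / 2) - (B / 2 - (1 - t)) * (G - \<mu> / 2 * d)"
    by (simp add: field_simps)
  also have "\<dots> \<le> (1 + (1 - t) * \<mu>) * (R / 2)"
  proof -
    have "0 \<le> (B / 2 - (1 - t)) * (G - \<mu> / 2 * d)"
      using B dG by (intro mult_nonneg_nonneg) auto
    moreover have "(1 + (1 - t) * \<mu>) * ((d + B * G) / 2) \<le> (1 + (1 - t) * \<mu>) * (R / 2)"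
      using bound t_bounds mu by (intro mult_left_mono) auto
    ultimately show ?thesis by linarith
  qed
  finally have "(1 - t) * G + d / 2 \<le> (1 + (1 - t) * \<mu>) / (1 + B / 2 * \<mu>) * (R / 2)"
    using B(2) by (simp only: times_divide_eq_left pos_le_divide_eq)
  then have "((1 - t) * G + d / 2) / t\<^sup>2 \<le> (1 + (1 - t) * \<mu>) / (1 + B / 2 * \<mu>) * (R / 2) / t\<^sup>2"
    by (rule divide_right_mono) simp
  moreover have "measure_pmf.expectation (approx gf \<psi> v D x0 K) (potential xs) = ((1 - t) * G + d / 2) / t\<^sup>2"
    by (simp add: approx_def potential_def G_def d_def add_divide_distrib)
  moreover have "R / 2 / t\<^sup>2 = potential xs x0"
  proof -
    have "(2 * (1 - t) * X + Y) / 2 / t\<^sup>2 = (1 - t) / t\<^sup>2 * X + 1 / (2 * t\<^sup>2) * Y" for X Y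
      using t_bounds(1) by (simp add: field_simps)
    then show ?thesis unfolding R_def potential_def .
  qed
  moreover have "t\<^sup>2 / (2 * (th (K - 1))\<^sup>2) = B / 2" by (simp add: B_def)
  ultimately show ?thesis by (metis times_divide_eq_right)
qed

lemma finite_approx_restart [simp]: "finite (set_pmf (approx_restart gf \<psi> v D Ks x0 r))"
  by (induction r) (auto simp: approx_def)

lemma approx_restart_Dom:
  assumes "x0 \<in> Dom"
  shows "set_pmf (approx_restart gf \<psi> v D Ks x0 r) \<subseteq> Dom"
proof (induction r)
  case (Suc r)
  then show ?case
    using Psi_le_split_Psi(1)[OF states_feasible last_weight_bounds] by (fastforce simp: approx_def)
qed (use assms in simp)

lemma approx_restart_contraction:
  fixes x0 xs :: "real^'n"
  assumes x0: "x0 \<in> Dom" and xs: "xs \<in> Dom" and min: "\<And>u. u \<in> Dom \<Longrightarrow> Fval xs \<le> Fval u"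
    and mu: "\<mu> > 0"
    and growth: "\<And>u. u \<in> Dom \<Longrightarrow> Fval xs + \<mu> / 2 * inner_wt v (u - xs) (u - xs) \<le> Fval u"
    and K: "real K \<ge> 1 / t"
  shows "measure_pmf.expectation (approx_restart gf \<psi> v D (\<lambda>_. K) x0 r) (potential xs)
    \<le> ((1 + (1 - t) * \<mu>) / (1 + t\<^sup>2 / (2 * (th (K - 1))\<^sup>2) * \<mu>)) ^ r * potential xs x0"
proof (induction r)
  case (Suc r)
  let ?P = "approx_restart gf \<psi> v D (\<lambda>_. K) x0 r"
  define \<rho> where "\<rho> = (1 + (1 - t) * \<mu>) / (1 + t\<^sup>2 / (2 * (th (K - 1))\<^sup>2) * \<mu>)"
  have "0 \<le> \<rho>" using t_bounds mu by (simp add: \<rho>_def)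
  have "measure_pmf.expectation (approx_restart gf \<psi> v D (\<lambda>_. K) x0 (Suc r)) (potential xs)
      = measure_pmf.expectation ?P (\<lambda>x. measure_pmf.expectation (approx gf \<psi> v D x K) (potential xs))"
    by (simp add: expectation_bind_finite approx_def)
  also have "\<dots> \<le> measure_pmf.expectation ?P (\<lambda>x. \<rho> * potential xs x)"
    unfolding \<rho>_def using approx_restart_Dom[OF x0]
    by (intro expectation_finite_mono approx_contraction xs min mu growth K) auto
  also have "\<dots> = \<rho> * measure_pmf.expectation ?P (potential xs)" by simp
  also have "\<dots> \<le> \<rho> * (\<rho> ^ r * potential xs x0)"
    using Suc \<open>0 \<le> \<rho>\<close> by (intro mult_left_mono) (simp_all add: \<rho>_def)
  finally show ?case by (simp add: \<rho>_def mult.assoc)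
qed simp

lemma objective_Dom: "x \<in> Dom \<Longrightarrow> objective f \<psi> x = ereal (Fval x)"
proof -
  assume "x \<in> Dom"
  then have "(\<Sum>i\<in>UNIV. \<psi> i (x $ i)) = (\<Sum>i\<in>UNIV. ereal (real_of_ereal (\<psi> i (x $ i))))"
    by (intro sum.cong) (auto simp: Dom_def closed_proper_convex_ereal[OF psi_cpc])
  then show ?thesis by (simp add: objective_def separable_def Psi_def)
qed

lemma separable_finite_iff: "separable \<psi> x < \<infinity> \<longleftrightarrow> x \<in> Dom"
proof -
  have "separable \<psi> x = \<infinity> \<longleftrightarrow> (\<exists>i. \<psi> i (x $ i) = \<infinity>)"
    unfolding separable_def by (simp add: sum_Pinfty)
  then show ?thesis by (auto simp: Dom_def eff_domain_def less_top[symmetric] top_ereal_def)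
qed

end

lemma expectation_ext_real:
  assumes "finite (set_pmf p)" "\<And>x. x \<in> set_pmf p \<Longrightarrow> X x = ereal (Y x)"
    and "\<And>x. x \<in> set_pmf p \<Longrightarrow> Y x \<ge> 0"
  shows "expectation_ext p X = ereal (measure_pmf.expectation p Y)"
proof -
  have "(\<integral>\<^sup>+ x. e2ennreal (X x) \<partial>measure_pmf p) = (\<integral>\<^sup>+ x. ennreal (Y x) \<partial>measure_pmf p)"
    by (intro nn_integral_cong_AE) (auto simp: AE_measure_pmf_iff assms(2) ennreal.abs_eq)
  also have "\<dots> = ennreal (measure_pmf.expectation p Y)"
    by (intro nn_integral_eq_integral integrable_measure_pmf_finite assms(1))
      (auto simp: AE_measure_pmf_iff assms(3))
  moreover have "0 \<le> measure_pmf.expectation p Y"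
    by (intro integral_nonneg_AE) (auto simp: AE_measure_pmf_iff assms(3))
  ultimately show ?thesis by (simp add: expectation_ext_def enn2ereal_ennreal)
qed

theorem corollary2:
  fixes f :: "real^'n::finite \<Rightarrow> real"
    and gf :: "real^'n \<Rightarrow> real^'n"
    and \<psi> :: "'n \<Rightarrow> real \<Rightarrow> ereal"
    and v x\<^sub>0 xstar :: "real^'n"
    and D :: "'n set pmf"
    and \<mu> \<theta>\<^sub>0 :: real
    and K r :: nat
  defines "F \<equiv> objective f \<psi>"
    and "\<theta>\<^sub>0 \<equiv> tau D / real CARD('n)"
  assumes f_convex: "convex_on UNIV f"
    and f_grad: "\<And>x. GDERIV f x :> gf x"
    and psi_cpc: "\<And>i. closed_proper_convex (\<psi> i)"
    and v_pos: "\<And>i. v $ i > 0"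
    and sampling: "uniform_sampling D"
    and tau_pos: "tau D > 0"
    and eso: "ESO f gf D v"
    and unique_minimizer: "minimizers F = {xstar}"
    and mu_pos: "\<mu> > 0"
    and growth: "\<And>x. F x < \<infinity> \<Longrightarrow>
      F x \<ge> minimum_value F + ereal (\<mu> / 2 * (norm_wt v (x - xstar))\<^sup>2)"
    and K_ge: "real K \<ge> real CARD('n) / tau D"
    and x0_dom: "separable \<psi> x\<^sub>0 < \<infinity>"
  shows "expectation_ext (approx_restart gf \<psi> v D (\<lambda>_. K) x\<^sub>0 r) (Delta F v \<theta>\<^sub>0)
    \<le> ereal (((1 + (1 - \<theta>\<^sub>0) * \<mu>) / (1 + \<theta>\<^sub>0\<^sup>2 / (2 * (theta_seq D (K - 1))\<^sup>2) * \<mu>)) ^ r)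
        * Delta F v \<theta>\<^sub>0 x\<^sub>0"
proof -
  interpret approx_setting f gf \<psi> v D
    using f_convex f_grad psi_cpc v_pos sampling tau_pos eso by unfold_locales
  have t: "\<theta>\<^sub>0 = t" by (simp add: \<theta>\<^sub>0_def t_def)
  have x0: "x\<^sub>0 \<in> Dom" using x0_dom separable_finite_iff by simp
  have xstar_le: "F xstar \<le> F y" for y using unique_minimizer by (auto simp: minimizers_def)
  have xstar: "xstar \<in> Dom"
  proof -
    have "F xstar < \<infinity>"
      using xstar_le[of "x\<^sub>0"] objective_Dom[OF x0] by (auto simp: F_def intro: le_less_trans)
    then have "separable \<psi> xstar \<noteq> \<infinity>" by (auto simp: F_def objective_def)
    then show ?thesis using separable_finite_iff[of xstar] by (simp add: less_top[symmetric] top_ereal_def)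
  qed
  have minval: "minimum_value F = ereal (Fval xstar)"
    unfolding minimum_value_def objective_Dom[OF xstar, symmetric] F_def[symmetric]
    by (intro antisym INF_lower INF_greatest xstar_le) simp
  have F: "F x = ereal (Fval x)" if "x \<in> Dom" for x using objective_Dom[OF that] by (simp add: F_def)
  have min: "Fval xstar \<le> Fval u" if "u \<in> Dom" for u
    using xstar_le[of u] by (simp add: F that xstar)
  have growth_real: "Fval xstar + \<mu> / 2 * inner_wt v (u - xstar) (u - xstar) \<le> Fval u" if "u \<in> Dom" for u
    using growth[of u] by (simp add: F that minval norm_wt_power2[OF v_pos])
  have Delta: "Delta F v \<theta>\<^sub>0 x = ereal (potential xstar x)" if "x \<in> Dom" for x
    by (simp add: Delta_def potential_def unique_minimizer dist_wt_def norm_wt_power2[OF v_pos]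
        F[OF that] minval t)
  have nonneg: "0 \<le> potential xstar x" if "x \<in> Dom" for x
    using min[OF that] t_bounds inner_wt_nonneg[of v "x - xstar"] v_pos by (simp add: potential_def)
  have K: "real K \<ge> 1 / t" using K_ge by (simp add: t_def)
  have "expectation_ext (approx_restart gf \<psi> v D (\<lambda>_. K) x\<^sub>0 r) (Delta F v \<theta>\<^sub>0)
      = ereal (measure_pmf.expectation (approx_restart gf \<psi> v D (\<lambda>_. K) x\<^sub>0 r) (potential xstar))"
    by (rule expectation_ext_real) (use approx_restart_Dom[OF x0] in \<open>auto intro: Delta nonneg\<close>)
  also have "\<dots> \<le> ereal (((1 + (1 - t) * \<mu>) / (1 + t\<^sup>2 / (2 * (th (K - 1))\<^sup>2) * \<mu>)) ^ r
      * potential xstar x\<^sub>0)"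
    using approx_restart_contraction[OF x0 xstar min mu_pos growth_real K] by simp
  finally show ?thesis
    unfolding Delta[OF x0] unfolding t theta_seq_def t_def[symmetric] by simp
qed

end
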